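(* Let $H$ be a multigraph with minimum degree $\delta(H) \geq 7$ and let $G$ be the line graph of $H$. Then $\chi_l(G) \leq \max\{\omega(G), \Delta(G)-1\}$.
   Context: Multigraphs are finite and may have parallel edges but no loops; the degree of a vertex of a multigraph counts incident edges with multiplicity. The line graph of a multigraph $H$ is the simple graph with vertex set $E(H)$ in which two distinct edges of $H$ are adjacent iff they share at least one endpoint (so parallel edges are adjacent). $\chi_l$ is the list chromatic number (choice number), $\omega$ the clique number, and $\Delta$ the maximum degree. *)

theory Defs
  imports "HOL-Library.Ramsey"
begin

section \<open>Multigraphs\<close>

text \<open>Edges are abstract objects, so that different edges may have the same ends.\<close>

record ('v, 'e) pre_multigraph =
  mverts :: "'v set"
  medges :: "'e set"
  ends :: "'e \<Rightarrow> 'v set"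

text \<open>Requiring exactly two ends excludes loops.\<close>

locale multigraph =
  fixes H :: "('v, 'e) pre_multigraph" (structure)
  assumes finite_mverts: "finite (mverts H)"
    and finite_medges: "finite (medges H)"
    and ends_subset: "e \<in> medges H \<Longrightarrow> ends H e \<subseteq> mverts H"
    and card_ends: "e \<in> medges H \<Longrightarrow> card (ends H e) = 2"

definition mdegree :: "('v, 'e) pre_multigraph \<Rightarrow> 'v \<Rightarrow> nat" where
  "mdegree H v = card {e \<in> medges H. v \<in> ends H e}"

definition min_mdegree :: "('v, 'e) pre_multigraph \<Rightarrow> nat" where
  "min_mdegree H = Min (mdegree H ` mverts H)"

section \<open>Simple graphs\<close>

record 'a pre_sgraph =
  sverts :: "'a set"
  sedges :: "'a set set"

locale sgraph =
  fixes G :: "'a pre_sgraph" (structure)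
  assumes finite_sverts: "finite (sverts G)"
    and sedges_subset: "sedges G \<subseteq> [sverts G]\<^bsup>2\<^esup>"

definition sdegree :: "'a pre_sgraph \<Rightarrow> 'a \<Rightarrow> nat" where
  "sdegree G v = card {w \<in> sverts G. {v, w} \<in> sedges G}"

text \<open>The inserted 0 only matters for the graph without vertices.\<close>

definition max_sdegree :: "'a pre_sgraph \<Rightarrow> nat" where
  "max_sdegree G = Max (insert 0 (sdegree G ` sverts G))"

definition clique_number :: "'a pre_sgraph \<Rightarrow> nat" where
  "clique_number G = Max {card K | K. K \<subseteq> sverts G \<and> clique K (sedges G)}"

definition proper_colouring :: "'a pre_sgraph \<Rightarrow> ('a \<Rightarrow> 'c) \<Rightarrow> bool" where
  "proper_colouring G c \<longleftrightarrow>
    (\<forall>v \<in> sverts G. \<forall>w \<in> sverts G. {v, w} \<in> sedges G \<longrightarrow> c v \<noteq> c w)"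

text \<open>
  The colours are natural numbers. This is no restriction: in a finite graph only finitely
  many colours occur in an assignment of finite lists, and they can be renamed injectively.
  The explicit finiteness matters for \<open>k = 0\<close>, because infinite sets have cardinality 0.
\<close>

definition choosable :: "'a pre_sgraph \<Rightarrow> nat \<Rightarrow> bool" where
  "choosable G k \<longleftrightarrow>
    (\<forall>L :: 'a \<Rightarrow> nat set. (\<forall>v \<in> sverts G. finite (L v) \<and> card (L v) = k) \<longrightarrow>
      (\<exists>c. proper_colouring G c \<and> (\<forall>v \<in> sverts G. c v \<in> L v)))"

definition list_chromatic_number :: "'a pre_sgraph \<Rightarrow> nat" where
  "list_chromatic_number G = (LEAST k. choosable G k)"

text \<open>The least number exists: lists as long as the graph admit an injective choice.\<close>

lemma (in sgraph) choosable_card: "choosable G (card (sverts G))"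
  unfolding choosable_def
proof (intro allI impI)
  fix L :: "'a \<Rightarrow> nat set"
  assume L: "\<forall>v \<in> sverts G. finite (L v) \<and> card (L v) = card (sverts G)"
  have "\<exists>c. inj_on c A \<and> (\<forall>v \<in> A. c v \<in> L v)" if "finite A" "A \<subseteq> sverts G" for A
    using that
  proof (induction A rule: finite_induct)
    case empty
    then show ?case by simp
  next
    case (insert a A)
    then obtain c where c: "inj_on c A" "\<forall>v \<in> A. c v \<in> L v" by auto
    have "card (c ` A) \<le> card A" using insert.hyps by (intro card_image_le)
    also have "\<dots> < card (insert a A)" using insert.hyps by simp
    also have "\<dots> \<le> card (L a)"
      using L insert.prems card_mono[OF finite_sverts insert.prems] by simp
    finally have "\<not> L a \<subseteq> c ` A"
      using card_mono[of "c ` A" "L a"] insert.hyps by auto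
    then obtain x where x: "x \<in> L a" "x \<notin> c ` A" by blast
    have "inj_on (c(a := x)) (insert a A)"
      using c x insert.hyps by (auto simp: inj_on_def)
    moreover have "\<forall>v \<in> insert a A. (c(a := x)) v \<in> L v" using c x by auto
    ultimately show ?case by blast
  qed
  from this[OF finite_sverts order_refl] obtain c
    where c: "inj_on c (sverts G)" "\<forall>v \<in> sverts G. c v \<in> L v" by blast
  have "proper_colouring G c"
    unfolding proper_colouring_def
    using c sedges_subset by (force dest: inj_onD)
  with c show "\<exists>c. proper_colouring G c \<and> (\<forall>v \<in> sverts G. c v \<in> L v)" by blast
qed

section \<open>Line graphs\<close>

definition line_graph :: "('v, 'e) pre_multigraph \<Rightarrow> 'e pre_sgraph" where
  "line_graph H =
    \<lparr>sverts = medges H,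
     sedges = {{e, f} | e f. e \<in> medges H \<and> f \<in> medges H \<and> e \<noteq> f \<and> ends H e \<inter> ends H f \<noteq> {}}\<rparr>"

lemma (in multigraph) sgraph_line_graph: "sgraph (line_graph H)"
  by unfold_locales (auto simp: line_graph_def finite_medges)

end

theory Submission
  imports Defs "HOL-Library.Product_Lexorder"
begin

text \<open>
  Let \<open>k\<close> be the claimed bound and let \<open>S\<close> be a minimal set of edges that cannot be coloured from
  certain lists of size \<open>k\<close>. Every edge of \<open>S\<close> then has \<open>k\<close> or \<open>k + 1\<close> neighbours in \<open>S\<close>, so at most
  one edge of \<open>H\<close> next to it is missing from \<open>S\<close>. The edges adjacent to a class of at least three
  parallel edges form two cliques; since a clique of size \<open>k + 1\<close> does not exist, colouring this
  configuration last shows that there are no classes of four edges, that a triple edge lies in no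
  triangle, and that two different triples meet only in a vertex of degree six.

  Now take a maximum cut of \<open>S\<close>. The remaining edges can be coloured by minimality, and the cut
  edges form a bipartite multigraph, to which Galvin's method applies: it needs preference
  orders at the vertices such that every cut edge is preferred to enough others. The orders
  of Borodin, Kostochka and Woodall suffice except for some triple edges. For those,
  moving both ends to the other sides of the cut would improve it unless the far end
  has many cut edges, and this leaves enough room to change the order there.
\<close>

section \<open>Systems of distinct representatives\<close>

text \<open>The number 7 comes from a count. When the other edges of \<open>S\<close> are coloured
  first, a cut edge \<open>e\<close> between \<open>x\<close> and \<open>y\<close> keeps at least
  \<open>dB x + dB y - card (par e) - 2 + slack e\<close> colours, where \<open>slack e\<close> is 1
  or 0 as \<open>e\<close> has \<open>k\<close> or \<open>k + 1\<close> neighbours in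
  \<open>S\<close>. Galvin's method therefore asks for \<open>card (par e) + 1 - slack e\<close>
  edges below \<open>e\<close> at its two ends together, while the orders of Borodin, Kostochka and
  Woodall supply the smaller cut degree minus one. So cut degrees of
  \<open>card (par e) + 2 - slack e\<close> are wanted. At most \<open>slack e\<close> edges of
  \<open>H\<close> at an end of \<open>e\<close> are missing from \<open>S\<close>, and a maximum
  cut keeps at least half of the edges at each vertex. Degree 7 thus yields cut degree at least
  \<open>4 - slack e\<close>, just enough for classes of one or two edges. A class of three falls
  short by at most one, and this single unit is what the structure of parallel classes and the
  modified orders have to regain.\<close>

theorem hall:
  fixes R :: "'a \<Rightarrow> 'b set"
  assumes "finite Q" "\<And>q. q \<in> Q \<Longrightarrow> finite (R q)"
    and "\<And>J. J \<subseteq> Q \<Longrightarrow> card J \<le> card (\<Union>(R ` J))"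
  shows "\<exists>c. inj_on c Q \<and> (\<forall>q \<in> Q. c q \<in> R q)"
  using assms
proof (induction "card Q" arbitrary: Q R rule: less_induct)
  case less
  note fQ = less.prems(1) and fR = less.prems(2) and hall = less.prems(3)
  show ?case
  \<comment> \<open>A tight proper subset splits the instance in two: Hall's condition is inherited
    inside, and outside it survives the removal of the colours used. Without such a set every proper
    nonempty subset has a colour to spare, so one representative can be fixed arbitrarily.\<close>
  proof (cases "\<exists>J. J \<subset> Q \<and> J \<noteq> {} \<and> card (\<Union>(R ` J)) = card J")
    case True
    then obtain J where J: "J \<subset> Q" "J \<noteq> {}" "card (\<Union>(R ` J)) = card J" by blast
    have fJ: "finite J" using J(1) fQ finite_subset by blast
    let ?U = "\<Union>(R ` J)"
    have fU: "finite ?U" using fJ fR J(1) by auto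
    have "card J < card Q" using J(1) fQ by (simp add: psubset_card_mono)
    then have "\<exists>c. inj_on c J \<and> (\<forall>q \<in> J. c q \<in> R q)"
    proof (rule less.hyps)
      show "card I \<le> card (\<Union>(R ` I))" if "I \<subseteq> J" for I using hall[of I] that J(1) by blast
      show "finite (R q)" if "q \<in> J" for q using fR that J(1) by blast
    qed (rule fJ)
    then obtain c1 where c1: "inj_on c1 J" "\<forall>q \<in> J. c1 q \<in> R q" by blast
    have lt: "card (Q - J) < card Q"
      using J fQ by (intro psubset_card_mono) auto
    have hK: "card K \<le> card (\<Union>((\<lambda>q. R q - ?U) ` K))" if K: "K \<subseteq> Q - J" for K
    proof -
      have fK: "finite K" using K fQ finite_subset by blast
      have "card (J \<union> K) \<le> card (\<Union>(R ` (J \<union> K)))" using hall[of "J \<union> K"] K J(1) by blast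
      also have "\<Union>(R ` (J \<union> K)) = ?U \<union> \<Union>((\<lambda>q. R q - ?U) ` K)" by auto
      also have "card \<dots> \<le> card ?U + card (\<Union>((\<lambda>q. R q - ?U) ` K))" by (rule card_Un_le)
      finally have "card (J \<union> K) \<le> card J + card (\<Union>((\<lambda>q. R q - ?U) ` K))" using J(3) by simp
      moreover have "J \<inter> K = {}" using K by blast
      ultimately show ?thesis using card_Un_disjoint[OF fJ fK] by simp
    qed
    have "finite (R q - ?U)" if "q \<in> Q - J" for q using fR that by blast
    then have "\<exists>c. inj_on c (Q - J) \<and> (\<forall>q \<in> Q - J. c q \<in> R q - ?U)"
      using less.hyps[of "Q - J" "\<lambda>q. R q - ?U", OF lt finite_Diff[OF fQ] _ hK] by simp
    then obtain c2 where "inj_on c2 (Q - J) \<and> (\<forall>q \<in> Q - J. c2 q \<in> R q - ?U)" ..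
    then have c2: "inj_on c2 (Q - J)" "\<forall>q \<in> Q - J. c2 q \<in> R q - ?U" by simp_all
    let ?c = "\<lambda>q. if q \<in> J then c1 q else c2 q"
    have "c1 q \<in> ?U" if "q \<in> J" for q using c1(2) that by blast
    moreover have "c2 q \<notin> ?U" if "q \<in> Q - J" for q using bspec[OF c2(2) that] by simp
    ultimately have "c1 q \<noteq> c2 q'" if "q \<in> J" "q' \<in> Q - J" for q q' using that by metis
    then have "c1 ` J \<inter> c2 ` (Q - J) = {}" by blast
    then have "inj_on ?c (J \<union> (Q - J))" by (intro inj_on_disjoint_Un c1(1) c2(1))
    moreover have "J \<union> (Q - J) = Q" using J(1) by blast
    ultimately have "inj_on ?c Q" by simp
    moreover have "\<forall>q \<in> Q. ?c q \<in> R q" using c1 c2 by auto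
    ultimately show ?thesis by (intro exI[of _ ?c] conjI)
  next
    case no_tight: False
    show ?thesis
    proof (cases "Q = {}")
      case False
      then obtain q where q: "q \<in> Q" by blast
      have "card {q} \<le> card (\<Union>(R ` {q}))" using hall[of "{q}"] q by blast
      then obtain x where x: "x \<in> R q" by fastforce
      have hK: "card K \<le> card (\<Union>((\<lambda>p. R p - {x}) ` K))" if K: "K \<subseteq> Q - {q}" for K
      proof (cases "K = {}")
        case nK: False
        have "K \<subset> Q" using K q by blast
        then have "card K < card (\<Union>(R ` K))"
          using no_tight nK hall[of K] by (metis order_le_less psubset_imp_subset)
        moreover have "\<Union>((\<lambda>p. R p - {x}) ` K) = \<Union>(R ` K) - {x}" by auto
        moreover have "card {x} = 1" by simp
        moreover have "card (\<Union>(R ` K)) - card {x} \<le> card (\<Union>(R ` K) - {x})"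
          by (rule diff_card_le_card_Diff) simp
        ultimately show ?thesis by (metis One_nat_def Suc_leI diff_le_mono diff_Suc_1 le_trans)
      qed simp
      have lt: "card (Q - {q}) < card Q" using q fQ by (meson card_Diff1_less)
      have "finite (R p - {x})" if "p \<in> Q - {q}" for p using fR that by blast
      then have "\<exists>c. inj_on c (Q - {q}) \<and> (\<forall>p \<in> Q - {q}. c p \<in> R p - {x})"
        using less.hyps[of "Q - {q}" "\<lambda>p. R p - {x}", OF lt finite_Diff[OF fQ] _ hK] by simp
      then obtain c where "inj_on c (Q - {q}) \<and> (\<forall>p \<in> Q - {q}. c p \<in> R p - {x})" ..
      then have c: "inj_on c (Q - {q})" "\<forall>p \<in> Q - {q}. c p \<in> R p - {x}" by simp_all
      have "inj_on (c(q := x)) Q" using c by (auto simp: inj_on_def)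
      moreover have "\<forall>p \<in> Q. (c(q := x)) p \<in> R p" using c x by auto
      ultimately show ?thesis by blast
    qed simp
  qed
qed

section \<open>Preferences in bipartite multigraphs\<close>

text \<open>
  A bipartite multigraph is given by the two end maps \<open>p\<close> and \<open>q\<close> of its edges. Smaller values
  of \<open>u\<close> and \<open>w\<close> mean that an edge is more preferred at its \<open>p\<close>-end and its \<open>q\<close>-end, respectively.
\<close>

definition pref_distinct :: "('e \<Rightarrow> 'v) \<Rightarrow> ('e \<Rightarrow> 'o) \<Rightarrow> 'e set \<Rightarrow> bool" where
  "pref_distinct p u S \<longleftrightarrow> (\<forall>e \<in> S. \<forall>f \<in> S. e \<noteq> f \<longrightarrow> p e = p f \<longrightarrow> u e \<noteq> u f)"

definition better :: "('e \<Rightarrow> 'v) \<Rightarrow> ('e \<Rightarrow> 'o::linorder) \<Rightarrow> 'e set \<Rightarrow> 'e \<Rightarrow> 'e set" where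
  "better p u S e = {f \<in> S. p f = p e \<and> u f < u e}"

definition worse :: "('e \<Rightarrow> 'v) \<Rightarrow> ('e \<Rightarrow> 'o::linorder) \<Rightarrow> 'e set \<Rightarrow> 'e \<Rightarrow> 'e set" where
  "worse p u S e = {f \<in> S. p f = p e \<and> u e < u f}"

lemma pref_distinct_subset: "pref_distinct p u S \<Longrightarrow> T \<subseteq> S \<Longrightarrow> pref_distinct p u T"
  by (auto simp: pref_distinct_def)

text \<open>Deferred acceptance by deletion: if two favourites at their \<open>p\<close>-ends
  collide at a \<open>q\<close>-end, the less preferred one is dropped and the rest is matched by
  induction. The set \<open>M\<close> is a kernel of the line graph oriented by the
  preferences.\<close>

theorem stable_matching:
  fixes p :: "'e \<Rightarrow> 'v" and q :: "'e \<Rightarrow> 'w" and u :: "'e \<Rightarrow> 'o::linorder" and w :: "'e \<Rightarrow> 'o'::linorder"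
  assumes "finite S" "pref_distinct p u S" "pref_distinct q w S"
  shows "\<exists>M \<subseteq> S. inj_on p M \<and> inj_on q M \<and>
    (\<forall>e \<in> S - M. better p u M e \<noteq> {} \<or> better q w M e \<noteq> {})"
  using assms
proof (induction "card S" arbitrary: S rule: less_induct)
  case less
  define T where "T = {e \<in> S. better p u S e = {}}"
  have T_sub: "T \<subseteq> S" by (auto simp: T_def)
  have inj_p: "inj_on p T"
    using less.prems(2) T_sub unfolding inj_on_def T_def better_def pref_distinct_def
    by (metis (mono_tags, lifting) empty_Collect_eq linorder_neqE mem_Collect_eq)
  show ?case
  proof (cases "inj_on q T")
    case True
    have "better p u T e \<noteq> {}" if e: "e \<in> S - T" for e
    proof -
      let ?C = "{f \<in> S. p f = p e}"
      have "finite (u ` ?C)" "u ` ?C \<noteq> {}" using less.prems(1) e by auto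
      then obtain f where f: "f \<in> ?C" "u f = Min (u ` ?C)" using Min_in by (metis (no_types, lifting) imageE)
      have min: "u f \<le> u g" if "g \<in> ?C" for g using that f(2) less.prems(1) by simp
      have "f \<in> T" using f min unfolding T_def better_def by (auto simp: leD)
      moreover have "u f \<noteq> u e"
        using less.prems(2) f(1) e \<open>f \<in> T\<close> unfolding pref_distinct_def by fastforce
      moreover have "u f \<le> u e" using min e by blast
      ultimately show ?thesis using f(1) unfolding better_def by auto
    qed
    then show ?thesis using True inj_p T_sub by blast
  next
    case False
    then obtain e1 e0 where e: "e1 \<in> T" "e0 \<in> T" "q e1 = q e0" "e1 \<noteq> e0" "w e1 < w e0"
      using less.prems(3) T_sub unfolding inj_on_def pref_distinct_def
      by (metis linorder_neqE subset_iff)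
    have "card (S - {e0}) < card S" using e(2) T_sub less.prems(1) by (meson card_Diff1_less subset_iff)
    then obtain M where M: "M \<subseteq> S - {e0}" "inj_on p M" "inj_on q M"
      "\<forall>e \<in> S - {e0} - M. better p u M e \<noteq> {} \<or> better q w M e \<noteq> {}"
      using less.hyps[of "S - {e0}"] less.prems pref_distinct_subset[of _ _ S "S - {e0}"]
      by (metis Diff_subset finite_Diff)
    \<comment> \<open>If \<open>e1\<close> is unmatched, it is blocked. As a favourite at its
      \<open>p\<close>-end it is blocked at the common \<open>q\<close>-end, and whatever blocks it
      there also blocks \<open>e0\<close>.\<close>
    have "better q w M e0 \<noteq> {}"
    proof (cases "e1 \<in> M")
      case True
      then show ?thesis using e by (auto simp: better_def)
    next
      case False
      have "better p u M e1 = {}" using e(1) M(1) by (auto simp: T_def better_def)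
      then have "better q w M e1 \<noteq> {}" using M(4) e T_sub False by blast
      then show ?thesis using e(3,5) by (auto simp: better_def dest: less_trans)
    qed
    then show ?thesis using M by (metis Diff_iff Diff_subset insertI1 singletonD subset_trans)
  qed
qed

text \<open>A stable matching \<open>M\<close> among the edges whose lists contain \<open>a\<close>
  receives the colour \<open>a\<close>. An edge outside \<open>M\<close> that loses \<open>a\<close>
  from its list also loses a better edge, so the strict inequality survives the induction.\<close>

theorem galvin_list_colouring:
  fixes p :: "'e \<Rightarrow> 'v" and q :: "'e \<Rightarrow> 'w" and u :: "'e \<Rightarrow> 'o::linorder" and w :: "'e \<Rightarrow> 'o'::linorder"
    and L :: "'e \<Rightarrow> 'c set"
  assumes "finite S" "pref_distinct p u S" "pref_distinct q w S"
    and "\<And>e. e \<in> S \<Longrightarrow> card (better p u S e) + card (better q w S e) < card (L e)"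
  shows "\<exists>c. (\<forall>e \<in> S. c e \<in> L e) \<and>
    (\<forall>e \<in> S. \<forall>f \<in> S. e \<noteq> f \<longrightarrow> p e = p f \<or> q e = q f \<longrightarrow> c e \<noteq> c f)"
  using assms
proof (induction "card S" arbitrary: S L rule: less_induct)
  case less
  show ?case
  proof (cases "S = {}")
    case False
    then obtain e0 where e0: "e0 \<in> S" by blast
    then have "L e0 \<noteq> {}" using less.prems(4)[of e0] by auto
    then obtain a where a: "a \<in> L e0" by blast
    define Sa where "Sa = {e \<in> S. a \<in> L e}"
    have Sa: "Sa \<subseteq> S" "finite Sa" using less.prems(1) by (auto simp: Sa_def)
    obtain M where M: "M \<subseteq> Sa" "inj_on p M" "inj_on q M"
      "\<forall>e \<in> Sa - M. better p u M e \<noteq> {} \<or> better q w M e \<noteq> {}"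
      using stable_matching[of Sa p u q w] Sa less.prems pref_distinct_subset by metis
    have "M \<noteq> {}" using M(4) a e0 by (auto simp: Sa_def better_def)
    then have "card (S - M) < card S"
      using M(1) Sa(1) less.prems(1) by (intro psubset_card_mono) auto
    moreover have "card (better p u (S - M) e) + card (better q w (S - M) e) < card (L e - {a})"
      if e: "e \<in> S - M" for e
    proof -
      have fin: "finite (better p u S e)" "finite (better q w S e)"
        using less.prems(1) by (auto simp: better_def)
      have sub: "better p u (S - M) e \<subseteq> better p u S e" "better q w (S - M) e \<subseteq> better q w S e"
        by (auto simp: better_def)
      show ?thesis
      proof (cases "a \<in> L e")
        case True
        then have "better p u M e \<noteq> {} \<or> better q w M e \<noteq> {}" using M(4) e by (auto simp: Sa_def)
        then have "better p u (S - M) e \<subset> better p u S e \<or> better q w (S - M) e \<subset> better q w S e"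
          using M(1) Sa(1) by (auto simp: better_def)
        then have "card (better p u (S - M) e) + card (better q w (S - M) e)
            < card (better p u S e) + card (better q w S e)"
          using card_mono[OF fin(1) sub(1)] card_mono[OF fin(2) sub(2)]
            psubset_card_mono[OF fin(1)] psubset_card_mono[OF fin(2)]
          by (metis add_le_less_mono add_less_le_mono)
        then show ?thesis using less.prems(4)[of e] e True by (simp add: card_Diff_singleton_if)
      next
        case False
        then show ?thesis using less.prems(4)[of e] e
            card_mono[OF fin(1) sub(1)] card_mono[OF fin(2) sub(2)] by simp
      qed
    qed
    ultimately obtain c where c: "\<forall>e \<in> S - M. c e \<in> L e - {a}"
      "\<forall>e \<in> S - M. \<forall>f \<in> S - M. e \<noteq> f \<longrightarrow> p e = p f \<or> q e = q f \<longrightarrow> c e \<noteq> c f"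
      using less.hyps[of "S - M" "\<lambda>e. L e - {a}"] less.prems(1-3)
        pref_distinct_subset[of _ _ S "S - M"] by (metis Diff_subset finite_Diff)
    let ?c = "\<lambda>e. if e \<in> M then a else c e"
    have "\<forall>e \<in> S. ?c e \<in> L e" using c(1) M(1) by (auto simp: Sa_def)
    moreover have "\<forall>e \<in> S. \<forall>f \<in> S. e \<noteq> f \<longrightarrow> p e = p f \<or> q e = q f \<longrightarrow> ?c e \<noteq> ?c f"
      using c M(2,3) unfolding inj_on_def by (smt (verit) Diff_iff singletonI)
    ultimately show ?thesis by (intro exI[of _ ?c]) blast
  qed simp
qed

definition fibre :: "('e \<Rightarrow> 'v) \<Rightarrow> 'e set \<Rightarrow> 'v \<Rightarrow> 'e set" where
  "fibre p S a = {e \<in> S. p e = a}"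

text \<open>
  A minimal set of vertices of degree \<open>D\<close> with at most as many neighbours of degree \<open>D\<close> satisfies
  Hall's condition, and with equality, so that one matching covers it together with these neighbours.
\<close>

lemma matching_covering_full_one_side:
  fixes p :: "'e \<Rightarrow> 'v" and q :: "'e \<Rightarrow> 'w"
  assumes fin: "finite S" and A: "A \<noteq> {}" "A \<subseteq> p ` S"
    and A_full: "\<And>a. a \<in> A \<Longrightarrow> card (fibre p S a) = D"
    and small: "card (q ` {e \<in> S. p e \<in> A \<and> card (fibre q S (q e)) = D}) \<le> card A"
  shows "\<exists>M \<subseteq> S. M \<noteq> {} \<and> inj_on p M \<and> inj_on q M \<and>
    (\<forall>e \<in> M. card (fibre p S (p e)) = D) \<and>
    (\<forall>e \<in> S. p e \<in> p ` M \<longrightarrow> card (fibre q S (q e)) = D \<longrightarrow> q e \<in> q ` M)"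
proof -
  define N where "N J = q ` {e \<in> S. p e \<in> J \<and> card (fibre q S (q e)) = D}" for J
  have finN: "finite (N J)" for J using fin by (simp add: N_def)
  define P where "P J \<longleftrightarrow> J \<noteq> {} \<and> J \<subseteq> A \<and> card (N J) \<le> card J" for J
  have "P A" using A small by (simp add: P_def N_def)
  then obtain J where J: "P J" and J_min: "\<And>I. P I \<Longrightarrow> card J \<le> card I"
    using ex_has_least_nat[of P A card] by blast
  have finA: "finite A" using A(2) fin finite_surj by blast
  have finJ: "finite J" using J finA finite_subset by (auto simp: P_def)
  have J_full: "card (fibre p S a) = D" if "a \<in> J" for a using A_full that J by (auto simp: P_def)
  show ?thesis
  proof (cases "N J = {}")
    case True
    \<comment> \<open>No neighbour of \<open>J\<close> has degree \<open>D\<close>, so a single edge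
      at \<open>J\<close> already is such a matching.\<close>
    obtain a where a: "a \<in> J" using J by (auto simp: P_def)
    then obtain e where e: "e \<in> S" "p e = a" using J A(2) by (auto simp: P_def)
    have "\<not> card (fibre q S (q f)) = D" if "f \<in> S" "p f = a" for f
      using True a that by (auto simp: N_def)
    then show ?thesis using e a J_full by (intro exI[of _ "{e}"]) auto
  next
    case False
    have hall_J: "card I \<le> card (N I)" if I: "I \<subseteq> J" for I
    proof (cases "I = {} \<or> I = J")
      case True
      \<comment> \<open>For \<open>J\<close> itself: by minimality, \<open>J\<close> without one
        vertex has strictly more neighbours of degree \<open>D\<close> than elements.\<close>
      have "card J \<le> card (N J)"
      proof -
        obtain a where a: "a \<in> J" using J by (auto simp: P_def)
        show ?thesis
        proof (cases "J = {a}")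
          case True
          then show ?thesis using False finN by (simp add: Suc_leI card_gt_0_iff)
        next
          case nJ: False
          have "card (J - {a}) < card J" using a finJ by (meson card_Diff1_less)
          then have "\<not> P (J - {a})" using J_min by (meson leD)
          then have "card (J - {a}) < card (N (J - {a}))" using nJ a J by (auto simp: P_def)
          also have "\<dots> \<le> card (N J)" by (intro card_mono finN) (auto simp: N_def)
          finally show ?thesis using a finJ by simp
        qed
      qed
      then show ?thesis using True by auto
    next
      case False
      then have "card I < card J" using I finJ by (meson psubsetI psubset_card_mono)
      then have "\<not> P I" using J_min by (meson leD)
      then show ?thesis using False I J by (auto simp: P_def)
    qed
    have N_UN: "\<Union>((\<lambda>a. N {a}) ` I) = N I" for I by (auto simp: N_def)
    obtain h where h: "inj_on h J" "\<forall>a \<in> J. h a \<in> N {a}"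
      using hall[of J "\<lambda>a. N {a}"] finJ finN hall_J unfolding N_UN by blast
    have "h ` J \<subseteq> N J" using h(2) by (auto simp: N_def)
    moreover have "card (h ` J) = card J" using h(1) by (rule card_image)
    \<comment> \<open>As \<open>card (N J) \<le> card J\<close>, the representatives exhaust
      \<open>N J\<close>; this is the covering condition.\<close>
    ultimately have hJ: "h ` J = N J"
      using J finN by (metis P_def card_seteq)
    have "\<forall>a \<in> J. \<exists>e. e \<in> S \<and> p e = a \<and> q e = h a" using h(2) by (fastforce simp: N_def)
    then obtain g where g: "\<And>a. a \<in> J \<Longrightarrow> g a \<in> S \<and> p (g a) = a \<and> q (g a) = h a" by metis
    have pM: "p ` g ` J = J" and qM: "q ` g ` J = N J" using g hJ by (force simp: image_image)+
    show ?thesis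
    proof (intro exI[of _ "g ` J"] conjI ballI impI)
      show "g ` J \<noteq> {}" using J by (auto simp: P_def)
      show "inj_on p (g ` J)" using g by (auto simp: inj_on_def)
      show "inj_on q (g ` J)" using g h(1) by (auto simp: inj_on_def)
      show "q e \<in> q ` g ` J" if "e \<in> S" "p e \<in> p ` g ` J" "card (fibre q S (q e)) = D" for e
        using that unfolding pM qM by (auto simp: N_def)
    qed (use g J_full in auto)
  qed
qed

text \<open>The side with more vertices of degree \<open>D\<close> works: their neighbours of degree
  \<open>D\<close> are among those of the other side, so there are few enough of them.\<close>

lemma matching_covering_full:
  fixes p :: "'e \<Rightarrow> 'v" and q :: "'e \<Rightarrow> 'w"
  assumes fin: "finite S"
    and full: "\<exists>e \<in> S. card (fibre p S (p e)) = D \<or> card (fibre q S (q e)) = D"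
  shows "(\<exists>M \<subseteq> S. M \<noteq> {} \<and> inj_on p M \<and> inj_on q M \<and>
      (\<forall>e \<in> M. card (fibre p S (p e)) = D) \<and>
      (\<forall>e \<in> S. p e \<in> p ` M \<longrightarrow> card (fibre q S (q e)) = D \<longrightarrow> q e \<in> q ` M))
    \<or> (\<exists>M \<subseteq> S. M \<noteq> {} \<and> inj_on q M \<and> inj_on p M \<and>
      (\<forall>e \<in> M. card (fibre q S (q e)) = D) \<and>
      (\<forall>e \<in> S. q e \<in> q ` M \<longrightarrow> card (fibre p S (p e)) = D \<longrightarrow> p e \<in> p ` M))"
proof -
  define P where "P = p ` {e \<in> S. card (fibre p S (p e)) = D}"
  define Q where "Q = q ` {e \<in> S. card (fibre q S (q e)) = D}"
  have finPQ: "finite P" "finite Q" using fin by (auto simp: P_def Q_def)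
  have P_full: "card (fibre p S a) = D" if "a \<in> P" for a using that by (auto simp: P_def)
  have Q_full: "card (fibre q S a) = D" if "a \<in> Q" for a using that by (auto simp: Q_def)
  have PS: "P \<subseteq> p ` S" and QS: "Q \<subseteq> q ` S" by (auto simp: P_def Q_def)
  let ?NP = "q ` {e \<in> S. p e \<in> P \<and> card (fibre q S (q e)) = D}"
  let ?NQ = "p ` {e \<in> S. q e \<in> Q \<and> card (fibre p S (p e)) = D}"
  have sub: "?NP \<subseteq> Q" "?NQ \<subseteq> P" by (auto simp: P_def Q_def)
  have le: "card ?NP \<le> card Q" "card ?NQ \<le> card P" using sub finPQ by (simp_all add: card_mono)
  have PQ: "P \<noteq> {} \<or> Q \<noteq> {}" using full unfolding P_def Q_def by blast
  have "P = {} \<Longrightarrow> card P = 0" "Q = {} \<Longrightarrow> card Q = 0" by simp_all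
  moreover have "card P = 0 \<Longrightarrow> P = {}" using finPQ by simp
  ultimately consider "P \<noteq> {}" "card ?NP \<le> card P" | "Q \<noteq> {}" "card ?NQ \<le> card Q"
    using PQ le by linarith
  then show ?thesis
  proof cases
    case 1
    show ?thesis
      by (rule disjI1, rule matching_covering_full_one_side[OF fin 1(1) PS _ 1(2)]) (rule P_full)
  next
    case 2
    show ?thesis
      by (rule disjI2, rule matching_covering_full_one_side[OF fin 2(1) QS _ 2(2)]) (rule Q_full)
  qed
qed

text \<open>The new matching goes to the top at its ends of degree \<open>D\<close> and to the bottom at the other ends.\<close>

lemma extend_preferences:
  fixes p :: "'e \<Rightarrow> 'v" and q :: "'e \<Rightarrow> 'w" and u w :: "'e \<Rightarrow> nat"
  assumes fin: "finite S" and M: "M \<subseteq> S" "inj_on p M" "inj_on q M"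
    and M_full: "\<And>e. e \<in> M \<Longrightarrow> card (fibre p S (p e)) = D"
    and cover: "\<And>e. e \<in> S \<Longrightarrow> p e \<in> p ` M \<Longrightarrow> card (fibre q S (q e)) = D \<Longrightarrow> q e \<in> q ` M"
    and le_D: "\<And>e. e \<in> S \<Longrightarrow> card (fibre q S (q e)) \<le> D"
    and dist: "pref_distinct p u (S - M)" "pref_distinct q w (S - M)"
    and worse: "\<And>e. e \<in> S - M \<Longrightarrow> min (card (fibre p (S - M) (p e))) (card (fibre q (S - M) (q e)))
      \<le> card (worse p u (S - M) e) + card (worse q w (S - M) e) + 1"
  shows "\<exists>(u' :: 'e \<Rightarrow> nat) (w' :: 'e \<Rightarrow> nat). pref_distinct p u' S \<and> pref_distinct q w' S \<and>
    (\<forall>e \<in> S. min (card (fibre p S (p e))) (card (fibre q S (q e)))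
      \<le> card (worse p u' S e) + card (worse q w' S e) + 1)"
proof -
  define u' where "u' e = (if e \<in> M then 0 else Suc (u e))" for e
  define K where "K = Suc (Max (insert 0 (w ` S)))"
  have K: "w e < K" if "e \<in> S" for e using that fin by (simp add: K_def less_Suc_eq_le)
  define w' where "w' e = (if e \<in> M then K else w e)" for e
  have "pref_distinct p u' S"
    using dist(1) M(2) by (auto simp: pref_distinct_def u'_def inj_on_def)
  moreover have "pref_distinct q w' S"
    using dist(2) M(3) K unfolding pref_distinct_def w'_def inj_on_def
    by (metis DiffI nat_neq_iff)
  moreover have "min (card (fibre p S (p e))) (card (fibre q S (q e)))
      \<le> card (worse p u' S e) + card (worse q w' S e) + 1" if e: "e \<in> S" for e
  proof (cases "e \<in> M")
    case True
    \<comment> \<open>An edge of \<open>M\<close> comes first at its \<open>p\<close>-end, so the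
      other edges there alone give the degree minus one.\<close>
    have "worse p u' S e = fibre p S (p e) - {e}"
      using True M(2) by (auto simp: worse_def u'_def fibre_def inj_on_def)
    moreover have "e \<in> fibre p S (p e)" using e by (simp add: fibre_def)
    ultimately show ?thesis using fin by (simp add: fibre_def)
  next
    case False
    let ?S' = "S - M"
    have finf: "finite (fibre p S a)" "finite (fibre q S b)" "finite (worse q w ?S' e)" for a b
      using fin by (auto simp: fibre_def worse_def)
    have step: "card (fibre r S x) = card (fibre r ?S' x) + (if x \<in> r ` M then 1 else 0)"
      if "inj_on r M" for r :: "'e \<Rightarrow> 'x" and x
    proof (cases "x \<in> r ` M")
      case True
      then obtain m where m: "m \<in> M" "r m = x" by blast
      then have "fibre r S x = insert m (fibre r ?S' x)"
        using that M(1) by (auto simp: fibre_def inj_on_def)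
      then show ?thesis using True m fin by (simp add: fibre_def)
    next
      case False
      then have "fibre r S x = fibre r ?S' x" by (auto simp: fibre_def)
      then show ?thesis using False by simp
    qed
    have wp: "worse p u' S e = worse p u ?S' e"
      using False by (auto simp: worse_def u'_def)
    have wq: "card (worse q w' S e) = card (worse q w ?S' e) + (if q e \<in> q ` M then 1 else 0)"
    proof (cases "q e \<in> q ` M")
      case True
      then obtain m where m: "m \<in> M" "q m = q e" by force
      then have "worse q w' S e = insert m (worse q w ?S' e)"
        using M(1,3) False K[OF e] by (auto simp: worse_def w'_def inj_on_def)
      then show ?thesis using True m finf by (simp add: worse_def)
    next
      case nq: False
      then have "x \<notin> M" if "q x = q e" for x using that by (metis imageI)
      then have "worse q w' S e = worse q w ?S' e"
        using False by (auto simp: worse_def w'_def)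
      then show ?thesis using nq by simp
    qed
    have main: "min (card (fibre p ?S' (p e))) (card (fibre q ?S' (q e)))
      \<le> card (worse p u ?S' e) + card (worse q w ?S' e) + 1" using worse e False by blast
    \<comment> \<open>The critical case is that \<open>M\<close> covers \<open>p e\<close> but not
      \<open>q e\<close>. Then \<open>q e\<close> has degree below \<open>D\<close>, the degree of
      \<open>p e\<close>, so the minimum is attained at \<open>q e\<close> and is the same before
      and after adding \<open>M\<close>.\<close>
    have pD: "card (fibre p S (p e)) = D" if "p e \<in> p ` M" using that M_full by force
    have qD: "card (fibre q S (q e)) < D" if "p e \<in> p ` M" "q e \<notin> q ` M"
      using that cover[OF e] le_D[OF e] by fastforce
    show ?thesis
      using main pD qD unfolding wp wq step[OF M(2), of "p e"] step[OF M(3), of "q e"]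
      by (cases "p e \<in> p ` M"; cases "q e \<in> q ` M") auto
  qed
  ultimately show ?thesis by blast
qed

text \<open>
  Together with \<open>galvin_list_colouring\<close> this gives the result of Borodin, Kostochka and Woodall that
  lists of size \<open>max (d x) (d y)\<close> at the edges \<open>x y\<close> suffice.
\<close>

theorem bipartite_preferences:
  fixes p :: "'e \<Rightarrow> 'v" and q :: "'e \<Rightarrow> 'w"
  assumes "finite S"
  shows "\<exists>(u :: 'e \<Rightarrow> nat) (w :: 'e \<Rightarrow> nat). pref_distinct p u S \<and> pref_distinct q w S \<and>
    (\<forall>e \<in> S. min (card (fibre p S (p e))) (card (fibre q S (q e)))
      \<le> card (worse p u S e) + card (worse q w S e) + 1)"
  using assms
proof (induction "card S" arbitrary: S rule: less_induct)
  case less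
  note fin = less.prems
  show ?case
  proof (cases "S = {}")
    case True
    then show ?thesis by (simp add: pref_distinct_def)
  next
    case False
    define D where "D = Max ((\<lambda>e. max (card (fibre p S (p e))) (card (fibre q S (q e)))) ` S)"
    have "D \<in> (\<lambda>e. max (card (fibre p S (p e))) (card (fibre q S (q e)))) ` S"
      using False fin by (simp add: D_def)
    then have full: "\<exists>e \<in> S. card (fibre p S (p e)) = D \<or> card (fibre q S (q e)) = D"
      by (auto simp: max_def split: if_splits)
    have "max (card (fibre p S (p e))) (card (fibre q S (q e))) \<le> D" if "e \<in> S" for e
      unfolding D_def by (rule Max_ge) (use that fin in auto)
    then have le_D: "card (fibre p S (p e)) \<le> D" "card (fibre q S (q e)) \<le> D" if "e \<in> S" for e
      using that by auto
    have IH: "\<exists>(u :: 'e \<Rightarrow> nat) (w :: 'e \<Rightarrow> nat).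
        pref_distinct p u (S - M) \<and> pref_distinct q w (S - M) \<and>
        (\<forall>e \<in> S - M. min (card (fibre p (S - M) (p e))) (card (fibre q (S - M) (q e)))
          \<le> card (worse p u (S - M) e) + card (worse q w (S - M) e) + 1)"
      if "M \<subseteq> S" "M \<noteq> {}" for M
      using that fin by (intro less.hyps psubset_card_mono) auto
    from matching_covering_full[OF fin full]
    show ?thesis
    proof (elim disjE exE conjE)
      fix M
      assume M: "M \<subseteq> S" "M \<noteq> {}" "inj_on p M" "inj_on q M"
        "\<forall>e \<in> M. card (fibre p S (p e)) = D"
        "\<forall>e \<in> S. p e \<in> p ` M \<longrightarrow> card (fibre q S (q e)) = D \<longrightarrow> q e \<in> q ` M"
      from IH[OF M(1,2)] obtain u w :: "'e \<Rightarrow> nat" where uw: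
        "pref_distinct p u (S - M)" "pref_distinct q w (S - M)"
        "\<And>e. e \<in> S - M \<Longrightarrow> min (card (fibre p (S - M) (p e))) (card (fibre q (S - M) (q e)))
          \<le> card (worse p u (S - M) e) + card (worse q w (S - M) e) + 1" by blast
      show ?thesis
        by (rule extend_preferences[OF fin M(1,3,4) _ _ le_D(2) uw]) (use M(5,6) in blast)+
    next
      fix M
      assume M: "M \<subseteq> S" "M \<noteq> {}" "inj_on q M" "inj_on p M"
        "\<forall>e \<in> M. card (fibre q S (q e)) = D"
        "\<forall>e \<in> S. q e \<in> q ` M \<longrightarrow> card (fibre p S (p e)) = D \<longrightarrow> p e \<in> p ` M"
      from IH[OF M(1,2)] obtain u w :: "'e \<Rightarrow> nat" where uw:
        "pref_distinct p u (S - M)" "pref_distinct q w (S - M)"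
        "\<And>e. e \<in> S - M \<Longrightarrow> min (card (fibre q (S - M) (q e))) (card (fibre p (S - M) (p e)))
          \<le> card (worse q w (S - M) e) + card (worse p u (S - M) e) + 1"
        by (metis (no_types, lifting) add.commute min.commute)
      have "\<exists>(w' :: 'e \<Rightarrow> nat) (u' :: 'e \<Rightarrow> nat). pref_distinct q w' S \<and> pref_distinct p u' S \<and>
        (\<forall>e \<in> S. min (card (fibre q S (q e))) (card (fibre p S (p e)))
          \<le> card (worse q w' S e) + card (worse p u' S e) + 1)"
        by (rule extend_preferences[OF fin M(1,3,4) _ _ le_D(1) uw(2,1,3)]) (use M(5,6) in blast)+
      then obtain w' u' :: "'e \<Rightarrow> nat" where *: "pref_distinct q w' S" "pref_distinct p u' S"
        "\<forall>e \<in> S. min (card (fibre q S (q e))) (card (fibre p S (p e)))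
          \<le> card (worse q w' S e) + card (worse p u' S e) + 1" by (elim exE conjE)
      have "\<forall>e \<in> S. min (card (fibre p S (p e))) (card (fibre q S (q e)))
          \<le> card (worse p u' S e) + card (worse q w' S e) + 1"
        using *(3) by (simp only: add.commute min.commute)
      with *(1,2) show ?thesis by (intro exI[of _ u'] exI[of _ w'] conjI)
    qed
  qed
qed

section \<open>Two cliques joined to a third one\<close>

definition list_colouring :: "('a \<Rightarrow> 'a \<Rightarrow> bool) \<Rightarrow> 'a set \<Rightarrow> ('a \<Rightarrow> 'c set) \<Rightarrow> ('a \<Rightarrow> 'c) \<Rightarrow> bool" where
  "list_colouring r S L c \<longleftrightarrow> (\<forall>x \<in> S. c x \<in> L x) \<and> (\<forall>x \<in> S. \<forall>y \<in> S. r x y \<longrightarrow> c x \<noteq> c y)"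

lemma greedy_extension:
  assumes fin: "finite S" and sym: "\<And>x y. r x y \<Longrightarrow> r y x" and irr: "\<And>x. \<not> r x x"
    and P: "P \<subseteq> S" "list_colouring r P L c"
    and large: "\<And>x. x \<in> S - P \<Longrightarrow> card {y \<in> S. r x y} < card (L x)"
  shows "\<exists>c'. list_colouring r S L c' \<and> (\<forall>x \<in> P. c' x = c x)"
proof -
  have "\<exists>c'. list_colouring r (P \<union> T) L c' \<and> (\<forall>x \<in> P. c' x = c x)" if "finite T" "T \<subseteq> S - P" for T
    using that
  proof (induction T rule: finite_induct)
    case empty
    then show ?case using P(2) by auto
  next
    case (insert x T)
    then obtain c' where c': "list_colouring r (P \<union> T) L c'" "\<forall>x \<in> P. c' x = c x" by blast
    let ?N = "{y \<in> P \<union> T. r x y}"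
    have "?N \<subseteq> {y \<in> S. r x y}" using P(1) insert.prems by blast
    then have "card ?N \<le> card {y \<in> S. r x y}" using fin by (intro card_mono) auto
    moreover have "finite ?N" using \<open>?N \<subseteq> _\<close> fin by (auto intro: finite_subset)
    ultimately have "card (c' ` ?N) < card (L x)"
      using large[of x] insert.prems card_image_le[of ?N c'] by force
    then have "\<not> L x \<subseteq> c' ` ?N"
      using card_mono[of "c' ` ?N" "L x"] \<open>finite ?N\<close> by force
    then obtain a where a: "a \<in> L x" "a \<notin> c' ` ?N" by blast
    have x: "x \<notin> P \<union> T" using insert by blast
    have "list_colouring r (P \<union> insert x T) L (c'(x := a))"
      unfolding list_colouring_def
    proof (intro conjI ballI impI)
      show "(c'(x := a)) u \<in> L u" if "u \<in> P \<union> insert x T" for u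
        using c'(1) a(1) that unfolding list_colouring_def by auto
    next
      fix u v assume uv: "u \<in> P \<union> insert x T" "v \<in> P \<union> insert x T" "r u v"
      have new: "a \<noteq> c' w" if "w \<in> P \<union> T" "r x w" for w using a(2) that by blast
      have old: "c' u \<noteq> c' v" if "u \<in> P \<union> T" "v \<in> P \<union> T"
        using c'(1) uv(3) that unfolding list_colouring_def by blast
      have "u \<noteq> v" using uv(3) irr by blast
      then show "(c'(x := a)) u \<noteq> (c'(x := a)) v"
        using uv new[of u] new[of v] old sym[OF uv(3)] by auto
    qed
    moreover have "\<forall>y \<in> P. (c'(x := a)) y = c y" using c'(2) x by auto
    ultimately show ?case by blast
  qed
  from this[of "S - P"] show ?thesis using fin P(1) by (simp add: Un_absorb1)
qed

text \<open>Hall's condition, sorted by size: sets missing two or more elements are served by any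
  single list (\<open>h1\<close>), sets missing one element by \<open>h2\<close>, and
  \<open>Q\<close> by \<open>h3\<close>. Later colourings fall short of complete lists by at most
  two, which is why these three conditions suffice.\<close>

lemma system_of_distinct_representatives:
  fixes R :: "'a \<Rightarrow> 'c set"
  assumes fin: "finite Q" "\<And>q. q \<in> Q \<Longrightarrow> finite (R q)"
    and h1: "\<And>q. q \<in> Q \<Longrightarrow> card Q \<le> card (R q) + 2"
    and h2: "\<And>q. q \<in> Q \<Longrightarrow> card Q \<le> card (\<Union>(R ` (Q - {q}))) + 1"
    and h3: "card Q \<le> card (\<Union>(R ` Q))"
  shows "\<exists>c. inj_on c Q \<and> (\<forall>q \<in> Q. c q \<in> R q)"
proof (rule hall[OF fin])
  fix J assume J: "J \<subseteq> Q"
  have finJ: "finite J" using J fin(1) finite_subset by blast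
  have finU: "finite (\<Union>(R ` J))" using finJ J fin(2) by auto
  show "card J \<le> card (\<Union>(R ` J))"
  proof (cases "J = Q")
    case True
    then show ?thesis using h3 by simp
  next
    case False
    then obtain q where q: "q \<in> Q" "J \<subseteq> Q - {q}" using J by blast
    have card_Q: "card (Q - {q}) + 1 = card Q" using q fin(1) by (metis card_Suc_Diff1 Suc_eq_plus1)
    show ?thesis
    proof (cases "J = Q - {q}")
      case True
      then show ?thesis using h2[OF q(1)] card_Q by simp
    next
      case False
      then have "card J < card (Q - {q})" using q(2) fin(1) by (intro psubset_card_mono) auto
      then have le: "card J + 2 \<le> card Q" using card_Q by simp
      show ?thesis
      proof (cases "J = {}")
        case False
        then obtain p where p: "p \<in> J" by blast
        then have "card (R p) \<le> card (\<Union>(R ` J))" using finU by (intro card_mono) auto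
        moreover have "card Q \<le> card (R p) + 2" using h1 J p by blast
        ultimately show ?thesis using le by linarith
      qed simp
    qed
  qed
qed

text \<open>
  \<open>Q\<close> is meant to be a clique completely joined to \<open>X \<union> Y\<close>. This need not be assumed,
  as all colourings constructed below are injective on \<open>Q\<close> and avoid the colours of \<open>Q\<close> elsewhere.
  For such \<open>Q\<close>, the lists on \<open>X \<union> Y\<close> are at most one smaller than the degrees.
\<close>

locale clique_pair =
  fixes r :: "'a \<Rightarrow> 'a \<Rightarrow> bool" and Q X Y :: "'a set" and L :: "'a \<Rightarrow> 'c set"
  assumes sym: "r x y \<Longrightarrow> r y x" and irr: "\<not> r x x"
    and finQ: "finite Q" and finX: "finite X" and finY: "finite Y"
    and disj: "Q \<inter> X = {}" "Q \<inter> Y = {}" "X \<inter> Y = {}"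
    and clX: "\<lbrakk>x \<in> X; x' \<in> X; x \<noteq> x'\<rbrakk> \<Longrightarrow> r x x'"
    and clY: "\<lbrakk>y \<in> Y; y' \<in> Y; y \<noteq> y'\<rbrakk> \<Longrightarrow> r y y'"
    and large: "x \<in> X \<union> Y \<Longrightarrow> card {z \<in> X \<union> Y. r x z} + card Q \<le> card (L x) + 1"
    and card_Q: "3 \<le> card Q"
    and finL: "q \<in> Q \<Longrightarrow> finite (L q)"
    and not_colourable: "\<not> list_colouring r (Q \<union> X \<union> Y) L c"
begin

lemma swap: "clique_pair r Q Y X L"
  using sym irr finQ finX finY disj clX clY large card_Q finL not_colourable
  by unfold_locales (auto simp: Un_ac Int_commute)

abbreviation "B \<equiv> X \<union> Y"

lemma finB: "finite B" using finX finY by simp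

lemma card_B: "card B = card X + card Y" using finX finY disj(3) by (rule card_Un_disjoint)

lemma finL': "x \<in> B \<Longrightarrow> finite (L x)"
  using large[of x] card_Q by (intro card_ge_0_finite) linarith

lemma card_LX:
  assumes "x \<in> X"
  shows "card X + card {y \<in> Y. r x y} + card Q \<le> card (L x) + 2"
proof -
  have "{z \<in> B. r x z} = (X - {x}) \<union> {y \<in> Y. r x y}" using clX assms irr by auto
  moreover have "card ((X - {x}) \<union> {y \<in> Y. r x y}) = card (X - {x}) + card {y \<in> Y. r x y}"
    using finX finY disj by (intro card_Un_disjoint) auto
  moreover have "card (X - {x}) + 1 = card X" using assms finX by (metis card_Suc_Diff1 Suc_eq_plus1)
  ultimately show ?thesis using large[of x] assms by simp
qed

lemma card_LY: "y \<in> Y \<Longrightarrow> card Y + card {x \<in> X. r y x} + card Q \<le> card (L y) + 2"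
  using clique_pair.card_LX[OF swap] .

text \<open>Since \<open>card Q \<ge> 3\<close>, the lists on \<open>B\<close> exceed the degrees
  within \<open>B\<close> by at least two. Any prescribed proper colours therefore extend greedily
  to \<open>B\<close>, and \<open>Q\<close> is left for last.\<close>

lemma extend_partial:
  assumes "P \<subseteq> B" "list_colouring r P L c"
  obtains c' where "list_colouring r B L c'" "\<forall>x \<in> P. c' x = c x"
proof -
  have "card {z \<in> B. r x z} < card (L x)" if "x \<in> B - P" for x
    using large[of x] card_Q that by simp
  from greedy_extension[OF finB sym irr assms this] show ?thesis using that by blast
qed

text \<open>Contradictions on a clique pair are obtained in this way: a colouring of
  \<open>B\<close> is completed on \<open>Q\<close> by distinct representatives of the remaining
  lists.\<close>

lemma colouring_fails:
  assumes c: "list_colouring r B L c"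
    and h1: "\<And>q. q \<in> Q \<Longrightarrow> card Q \<le> card (L q - c ` B) + 2"
    and h2: "\<And>q. q \<in> Q \<Longrightarrow> card Q \<le> card (\<Union>q' \<in> Q - {q}. L q' - c ` B) + 1"
    and h3: "card Q \<le> card (\<Union>q \<in> Q. L q - c ` B)"
  shows False
proof -
  have "finite (L q - c ` B)" if "q \<in> Q" for q using finL that by blast
  from system_of_distinct_representatives[OF finQ this h1 h2 h3]
  obtain g where g: "inj_on g Q" "\<And>q. q \<in> Q \<Longrightarrow> g q \<in> L q - c ` B" by blast
  have g': "g q \<in> L q" "b \<in> B \<Longrightarrow> g q \<noteq> c b" if "q \<in> Q" for q b using g(2)[OF that] by auto
  let ?c = "\<lambda>x. if x \<in> Q then g x else c x"
  have "list_colouring r (Q \<union> X \<union> Y) L ?c"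
    unfolding list_colouring_def
  proof (intro conjI ballI impI)
    fix x y assume xy: "x \<in> Q \<union> X \<union> Y" "y \<in> Q \<union> X \<union> Y" "r x y"
    then have "x \<noteq> y" using irr by blast
    show "?c x \<noteq> ?c y"
    proof -
      have "c x \<noteq> c y" if "x \<in> B" "y \<in> B" using c xy(3) that unfolding list_colouring_def by blast
      moreover have "g x \<noteq> g y" if "x \<in> Q" "y \<in> Q" using g(1) \<open>x \<noteq> y\<close> that by (meson inj_onD)
      moreover have "g x \<noteq> c y" if "x \<in> Q" "y \<in> B" using g'(2) that by blast
      moreover have "c x \<noteq> g y" if "x \<in> B" "y \<in> Q" using g'(2)[OF that(2,1)] by simp
      moreover have "x \<in> Q \<or> x \<in> B" "y \<in> Q \<or> y \<in> B" using xy by blast+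
      ultimately show ?thesis by presburger
    qed
  qed (use g' c in \<open>auto simp: list_colouring_def\<close>)
  then show False using not_colourable by blast
qed

lemma finU: "J \<subseteq> Q \<Longrightarrow> finite (\<Union>q \<in> J. L q - A)"
  using finL finQ by (meson finite_Diff finite_UN_I finite_subset subset_iff)

lemma card_U: "q \<in> J \<Longrightarrow> J \<subseteq> Q \<Longrightarrow> card (L q - A) \<le> card (\<Union>q \<in> J. L q - A)"
  by (intro card_mono finU) auto

lemma other: "\<exists>q' \<in> Q. q' \<noteq> q"
proof (rule ccontr)
  assume "\<not> ?thesis"
  then have "card Q \<le> card {q}" by (intro card_mono) auto
  then show False using card_Q by simp
qed

text \<open>Every set containing \<open>q1\<close> satisfies Hall's condition through the remaining
  list of \<open>q1\<close> alone, so among the large sets only \<open>Q - {q1}\<close> is left to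
  check.\<close>

lemma colouring_fails_saving_two:
  assumes c: "list_colouring r B L c"
    and h1: "\<And>q. q \<in> Q \<Longrightarrow> card Q \<le> card (L q - c ` B) + 2"
    and q1: "q1 \<in> Q" "card Q \<le> card (L q1 - c ` B)"
    and h2: "card Q \<le> card (\<Union>q' \<in> Q - {q1}. L q' - c ` B) + 1"
  shows False
proof (rule colouring_fails[OF c h1])
  show "card Q \<le> card (\<Union>q' \<in> Q - {q}. L q' - c ` B) + 1" if "q \<in> Q" for q
    using h2 card_U[of q1 "Q - {q}" "c ` B"] q1 by (cases "q = q1") auto
  show "card Q \<le> card (\<Union>q \<in> Q. L q - c ` B)"
    using card_U[of q1 Q "c ` B"] q1 by simp
qed

lemma colouring_fails_union:
  assumes c: "list_colouring r B L c"
    and h1: "\<And>q. q \<in> Q \<Longrightarrow> card Q \<le> card (L q - c ` B) + 1"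
    and h3: "card Q \<le> card (\<Union>q \<in> Q. L q - c ` B)"
  shows False
proof (rule colouring_fails[OF c _ _ h3])
  fix q assume q: "q \<in> Q"
  show "card Q \<le> card (L q - c ` B) + 2" using h1[OF q] by simp
  obtain q' where q': "q' \<in> Q" "q' \<noteq> q" using other by blast
  show "card Q \<le> card (\<Union>q' \<in> Q - {q}. L q' - c ` B) + 1"
    using h1[OF q'(1)] card_U[of q' "Q - {q}" "c ` B"] q' by auto
qed

lemma colouring_fails_saving_one:
  assumes c: "list_colouring r B L c"
    and h1: "\<And>q. q \<in> Q \<Longrightarrow> card Q \<le> card (L q - c ` B) + 1"
    and q1: "q1 \<in> Q" "card Q \<le> card (L q1 - c ` B)"
  shows False
  using colouring_fails_union[OF c h1] card_U[of q1 Q "c ` B"] q1 by auto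

lemma saved:
  assumes "Z \<subseteq> B" "\<And>z. z \<in> Z \<Longrightarrow> c z \<notin> L q \<or> (\<exists>w \<in> B - Z. c w = c z)" "q \<in> Q"
  shows "card (L q) + card Z \<le> card (L q - c ` B) + card B"
proof -
  have "c b \<in> c ` (B - Z)" if "b \<in> B" "c b \<in> L q" for b
    using assms(2)[of b] that by (metis DiffI image_eqI)
  then have "c ` B \<inter> L q \<subseteq> c ` (B - Z)" by blast
  then have "card (c ` B \<inter> L q) \<le> card (c ` (B - Z))" using finB by (intro card_mono) auto
  also have "\<dots> \<le> card (B - Z)" using finB by (intro card_image_le) auto
  also have "\<dots> = card B - card Z" using assms(1) finB by (meson card_Diff_subset finite_subset)
  finally have "card (c ` B \<inter> L q) + card Z \<le> card B"
    using card_mono[OF finB assms(1)] by linarith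
  moreover have "card (L q) = card (L q - c ` B) + card (L q \<inter> c ` B)"
    using finL[OF assms(3)] by (metis card_Diff_subset_Int card_mono finite_Int inf_le1 le_add_diff_inverse2)
  ultimately show ?thesis by (simp add: Int_commute)
qed

lemma no_neighbour_X: "card {y \<in> Y. r x y} = 0 \<Longrightarrow> y \<in> Y \<Longrightarrow> \<not> r x y" using finY by auto

lemma no_neighbour_Y: "card {x \<in> X. r y x} = 0 \<Longrightarrow> x \<in> X \<Longrightarrow> \<not> r x y" using finX sym by auto

text \<open>Here one saving for one member of \<open>Q\<close> would suffice. Hence nonadjacent
  \<open>x\<close> and \<open>y\<close> share no colour and have no colour outside any
  \<open>L q\<close>, so \<open>L x\<close> and \<open>L y\<close> are disjoint parts of
  \<open>L q\<close>. Comparing sizes gives that \<open>card Q\<close> plus the numbers of cross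
  neighbours of \<open>x\<close> and \<open>y\<close> is at most 3. All inequalities are thus
  equalities, and \<open>L x\<close> is the complement of \<open>L y\<close> in
  \<open>L q\<close>.\<close>

lemma rigid_of_one_pair:
  assumes card_Lq: "\<And>q. q \<in> Q \<Longrightarrow> card (L q) + 1 = card B + card Q"
    and xy0: "x0 \<in> X" "y0 \<in> Y" "\<not> r x0 y0"
  shows "card Q = 3 \<and> (\<forall>x \<in> X. \<forall>y \<in> Y. \<not> r x y) \<and> (\<exists>A. card A = card X + 1 \<and> (\<forall>x \<in> X. L x = A))"
proof -
  obtain q0 where q0: "q0 \<in> Q" using card_Q by fastforce
  have pair: "L x \<inter> L y = {}" "q \<in> Q \<Longrightarrow> L x \<union> L y \<subseteq> L q" if xy: "x \<in> X" "y \<in> Y" "\<not> r x y" for x y q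
  proof -
    have ne: "x \<noteq> y" using xy disj by blast
    have nr: "\<not> r y x" using xy sym by blast
    show *: "L x \<inter> L y = {}"
    proof (rule ccontr)
      assume "L x \<inter> L y \<noteq> {}"
      then obtain a where a: "a \<in> L x" "a \<in> L y" by blast
      have "list_colouring r {x, y} L (\<lambda>_. a)"
        using a xy nr irr by (auto simp: list_colouring_def)
      then obtain c where c: "list_colouring r B L c" "c x = a" "c y = a"
        using extend_partial[of "{x, y}" "\<lambda>_. a"] xy by auto
      have "card Q \<le> card (L q - c ` B)" if "q \<in> Q" for q
      proof -
        have "\<exists>w \<in> B - {x}. c w = c x" using c xy ne by (intro bexI[of _ y]) auto
        then have "card (L q) + card {x} \<le> card (L q - c ` B) + card B"
          using saved[of "{x}" c q] that xy by blast
        then show ?thesis using card_Lq[OF that] by simp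
      qed
      then show False using colouring_fails_saving_one[OF c(1) _ q0] q0 by (metis le_add1 le_trans)
    qed
    show "L x \<union> L y \<subseteq> L q" if q: "q \<in> Q"
    proof (rule ccontr)
      assume "\<not> L x \<union> L y \<subseteq> L q"
      then obtain z a where z: "z \<in> {x, y}" "a \<in> L z" "a \<notin> L q" by blast
      have zB: "z \<in> B" using z xy by blast
      have "list_colouring r {z} L (\<lambda>_. a)" using z irr by (auto simp: list_colouring_def)
      then obtain c where c: "list_colouring r B L c" "c z = a"
        using extend_partial[of "{z}" "\<lambda>_. a"] zB by auto
      have "card Q \<le> card (L p - c ` B) + 1" if "p \<in> Q" for p
        using saved[of "{}" c p] card_Lq[OF that] that by auto
      moreover have "card (L q) + card {z} \<le> card (L q - c ` B) + card B"
        using saved[of "{z}" c q] q zB c z by blast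
      then have "card Q \<le> card (L q - c ` B)" using card_Lq[OF q] by simp
      ultimately show False using colouring_fails_saving_one[OF c(1) _ q] by blast
    qed
  qed
  have sizes: "card Q = 3 \<and> card {y \<in> Y. r x y} = 0 \<and> card {x \<in> X. r y x} = 0
      \<and> card (L x) = card X + 1 \<and> L x = L q0 - L y"
    if xy: "x \<in> X" "y \<in> Y" "\<not> r x y" for x y
  proof -
    have U: "card (L x \<union> L y) = card (L x) + card (L y)"
      using pair(1)[OF xy] finL' xy by (intro card_Un_disjoint) auto
    have "card (L x \<union> L y) \<le> card (L q0)"
      by (rule card_mono[OF finL[OF q0] pair(2)[OF xy q0]])
    then have *: "card (L x) + card (L y) \<le> card (L q0)" using U by simp
    have "card (L x \<union> L y) = card (L q0)"
      using * U card_LX[OF xy(1)] card_LY[OF xy(2)] card_Lq[OF q0] card_B card_Q by linarith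
    from card_subset_eq[OF finL[OF q0] pair(2)[OF xy q0] this] have "L x \<union> L y = L q0" .
    then have "L x = L q0 - L y" using pair(1)[OF xy] by blast
    moreover have "card Q = 3" "card {y \<in> Y. r x y} = 0" "card {x \<in> X. r y x} = 0"
      "card (L x) = card X + 1"
      using * card_LX[OF xy(1)] card_LY[OF xy(2)] card_Lq[OF q0] card_B card_Q by linarith+
    ultimately show ?thesis by blast
  qed
  have no_y0: "\<not> r x y0" if "x \<in> X" for x using no_neighbour_Y[OF _ that] sizes[OF xy0] by blast
  have "\<not> r x y" if "x \<in> X" "y \<in> Y" for x y
    using no_neighbour_X[OF _ that(2)] sizes[OF that(1) xy0(2) no_y0[OF that(1)]] by blast
  moreover have L_X: "L x = L q0 - L y0" if "x \<in> X" for x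
    using sizes[OF that xy0(2) no_y0[OF that]] by blast
  moreover have "card (L q0 - L y0) = card X + 1" using sizes[OF xy0] L_X[OF xy0(1)] by simp
  moreover have "card Q = 3" using sizes[OF xy0] by simp
  ultimately show ?thesis by (intro conjI exI[of _ "L q0 - L y0"]) simp_all
qed

end

section \<open>Lists on \<open>Q\<close> that need two savings: rigidity from two disjoint
  nonadjacent pairs\<close>

context clique_pair
begin

context
  assumes card_Lq: "q \<in> Q \<Longrightarrow> card (L q) + 2 = card B + card Q"
begin

lemma saved':
  assumes "Z \<subseteq> B" "\<And>z. z \<in> Z \<Longrightarrow> c z \<notin> L q \<or> (\<exists>w \<in> B - Z. c w = c z)" "q \<in> Q"
  shows "card Q + card Z \<le> card (L q - c ` B) + 2"
  using saved[OF assms] card_Lq[OF assms(3)] by simp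

text \<open>Colouring \<open>x1\<close> and \<open>y1\<close> with \<open>a\<close> saves one colour
  for everybody, so a second saving for any \<open>q\<close> is impossible. The second pair
  therefore shares at most \<open>a\<close> and uses only colours of \<open>L q\<close>; the count
  of \<open>rigid_of_one_pair\<close> applies again, with overlap one instead of zero.\<close>

lemma shared_colour:
  assumes xy1: "x1 \<in> X" "y1 \<in> Y" "\<not> r x1 y1" and xy2: "x2 \<in> X" "y2 \<in> Y" "\<not> r x2 y2"
    and ne: "x1 \<noteq> x2" "y1 \<noteq> y2" and a: "a \<in> L x1" "a \<in> L y1" and q: "q \<in> Q"
  shows "card Q = 3 \<and> card {y \<in> Y. r x2 y} = 0 \<and> card {x \<in> X. r y2 x} = 0
    \<and> card (L x2) = card X + 1 \<and> L x2 \<union> L y2 = L q \<and> L x2 \<inter> L y2 = {a}"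
proof -
  have nr: "\<not> r y1 x1" "\<not> r y2 x2" using xy1 xy2 sym by blast+
  have nexy: "x1 \<noteq> y1" "x2 \<noteq> y2" "x1 \<noteq> y2" "x2 \<noteq> y1" using xy1 xy2 disj by blast+
  have inB: "x1 \<in> B" "y1 \<in> B" "x2 \<in> B" "y2 \<in> B" using xy1 xy2 by simp_all
  have no_other: "L x2 \<inter> L y2 \<subseteq> {a}"
  proof (rule ccontr)
    assume "\<not> L x2 \<inter> L y2 \<subseteq> {a}"
    then obtain d where d: "d \<in> L x2" "d \<in> L y2" "d \<noteq> a" by blast
    let ?f = "\<lambda>z. if z \<in> {x1, y1} then a else d"
    have "list_colouring r {x1, y1, x2, y2} L ?f"
      using a d nr xy1 xy2 irr ne nexy by (auto simp: list_colouring_def)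
    then obtain c where c: "list_colouring r B L c" "\<forall>z \<in> {x1, y1, x2, y2}. c z = ?f z"
      by (rule extend_partial[rotated]) (use inB in auto)
    have cz: "c x1 = a" "c y1 = a" "c x2 = d" "c y2 = d" using c(2) ne nexy by auto
    have big: "card Q \<le> card (L p - c ` B)" if "p \<in> Q" for p
    proof -
      have "\<exists>w \<in> B - {x1, x2}. c w = c z" if "z \<in> {x1, x2}" for z
        using that cz inB ne nexy by (metis DiffI insertE singletonD)
      then have "card Q + card {x1, x2} \<le> card (L p - c ` B) + 2"
        using inB \<open>p \<in> Q\<close> by (intro saved') auto
      then show ?thesis using ne(1) by simp
    qed
    show False by (rule colouring_fails_saving_one[OF c(1) _ q big[OF q]]) (use big in fastforce)
  qed
  have in_q: "a \<in> L q \<and> L x2 \<union> L y2 \<subseteq> L q"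
  proof (rule ccontr)
    assume outside: "\<not> ?thesis"
    \<comment> \<open>If \<open>a\<close> is outside \<open>L q\<close>, using it on
      \<open>x1\<close> and \<open>y1\<close> saves two colours for \<open>q\<close> at once.
      Otherwise a colour outside \<open>L q\<close> on the second pair differs from \<open>a\<close>
      and gives the second saving.\<close>
    have "\<exists>z \<in> {x1, x2, y2}. \<exists>d \<in> L z - L q. if z = x1 then d = a else d \<noteq> a"
    proof (cases "a \<in> L q")
      case True
      then obtain z d where "z \<in> {x2, y2}" "d \<in> L z - L q" using outside by blast
      then show ?thesis using True ne nexy by (intro bexI[of _ z] bexI[of _ d]) auto
    next
      case False
      then show ?thesis using a(1) by (intro bexI[of _ x1] bexI[of _ a]) auto
    qed
    then obtain z d where z: "z \<in> {x1, x2, y2}" "d \<in> L z" "d \<notin> L q" "z = x1 \<longrightarrow> d = a"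
      "z \<noteq> x1 \<longrightarrow> d \<noteq> a"
      by (metis (mono_tags, lifting) DiffD1 DiffD2)
    let ?f = "\<lambda>v. if v \<in> {x1, y1} then a else d"
    have zB: "z \<in> B" using z(1) inB by blast
    have "list_colouring r {x1, y1, z} L ?f"
      using a z nr xy1 irr ne nexy by (auto simp: list_colouring_def)
    then obtain c where c: "list_colouring r B L c" "\<forall>v \<in> {x1, y1, z}. c v = ?f v"
      by (rule extend_partial[rotated]) (use inB zB in auto)
    have cz: "c x1 = a" "c y1 = a" "c z = d" using c(2) z nexy ne by auto
    have "card Q \<le> card (L p - c ` B) + 1" if "p \<in> Q" for p
    proof -
      have "\<exists>w \<in> B - {x1}. c w = c x1" using cz inB nexy by (intro bexI[of _ y1]) auto
      then have "card Q + card {x1} \<le> card (L p - c ` B) + 2"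
        using inB that by (intro saved') auto
      then show ?thesis by simp
    qed
    moreover have "card Q \<le> card (L q - c ` B)"
    proof (cases "z = x1")
      case True
      then have "card Q + card {x1, y1} \<le> card (L q - c ` B) + 2"
        using inB q cz z by (intro saved') auto
      then show ?thesis using nexy by simp
    next
      case False
      have "\<exists>w \<in> B - {x1, z}. c w = c x1" using cz inB nexy z ne by (intro bexI[of _ y1]) auto
      then have "card Q + card {x1, z} \<le> card (L q - c ` B) + 2"
        using inB zB q cz z by (intro saved') auto
      then show ?thesis using False by simp
    qed
    ultimately show False using colouring_fails_saving_one[OF c(1) _ q] by blast
  qed
  have fin: "finite (L x2)" "finite (L y2)" using inB finL' by blast+
  have sum: "card (L x2) + card (L y2) = card (L x2 \<union> L y2) + card (L x2 \<inter> L y2)"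
    using fin by (rule card_Un_Int)
  have le1: "card (L x2 \<inter> L y2) \<le> 1" using card_mono[OF _ no_other] by simp
  have leq: "card (L x2 \<union> L y2) \<le> card (L q)" using in_q finL[OF q] by (intro card_mono) auto
  note sizes = card_LX[OF xy2(1)] card_LY[OF xy2(2)] card_Lq[OF q] card_B card_Q
  have "card (L x2 \<union> L y2) = card (L q)" using sum le1 leq sizes by linarith
  then have "L x2 \<union> L y2 = L q" using in_q finL[OF q] by (intro card_subset_eq) auto
  moreover have "card (L x2 \<inter> L y2) = 1" using sum le1 leq sizes by linarith
  then have "L x2 \<inter> L y2 = {a}" using no_other by (metis card.empty subset_singletonD zero_neq_one)
  moreover have "card Q = 3" "card {y \<in> Y. r x2 y} = 0" "card {x \<in> X. r y2 x} = 0"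
    "card (L x2) = card X + 1"
    using sum le1 leq sizes by linarith+
  ultimately show ?thesis by blast
qed

text \<open>Two disjoint lists on a pair have together at least \<open>card Q - 2\<close> more
  colours than \<open>L q\<close>. Each colour outside \<open>L q\<close> is a possible saving for
  \<open>q\<close>.\<close>

lemma missing_colours:
  assumes xy: "x \<in> X" "y \<in> Y" and q: "q \<in> Q" and dj: "L x \<inter> L y = {}"
  shows "card Q + card {y' \<in> Y. r x y'} + card {x' \<in> X. r y x'} \<le> card (L x \<union> L y - L q) + 2"
    and "L x \<union> L y - L q \<noteq> {}"
proof -
  have fin: "finite (L x \<union> L y)" using xy finL' by blast
  have "card (L x \<union> L y) = card (L x) + card (L y)"
    using dj fin by (intro card_Un_disjoint) auto
  moreover have "card (L x \<union> L y) \<le> card (L x \<union> L y - L q) + card (L q)"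
    using diff_card_le_card_Diff[OF finL[OF q], of "L x \<union> L y"] by simp
  ultimately show *: "card Q + card {y' \<in> Y. r x y'} + card {x' \<in> X. r y x'} \<le> card (L x \<union> L y - L q) + 2"
    using card_LX[OF xy(1)] card_LY[OF xy(2)] card_Lq[OF q] card_B by linarith
  show "L x \<union> L y - L q \<noteq> {}" using * card_Q by force
qed

text \<open>A colouring with two savings for \<open>q1\<close> alone need not be completable, but
  the way in which it fails determines the other lists on \<open>Q\<close>, and a second colouring
  exploits this.\<close>

lemma no_two_savings:
  assumes xy1: "x1 \<in> X" "y1 \<in> Y" and xy2: "x2 \<in> X" "y2 \<in> Y"
    and ne: "x1 \<noteq> x2" "y1 \<noteq> y2" and dj: "L x1 \<inter> L y1 = {}"
    and q1: "q1 \<in> Q" and z1: "z1 \<in> {x1, y1}" "d1 \<in> L z1 - L q1" and z2: "z2 \<in> {x2, y2}" "d2 \<in> L z2 - L q1"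
    and ok: "d1 \<noteq> d2 \<or> \<not> r z1 z2"
  shows False
proof -
  have nexy: "x1 \<noteq> y2" "x2 \<noteq> y1" using xy1 xy2 disj by blast+
  have nez: "z \<noteq> z2" if "z \<in> {x1, y1}" for z using that z2(1) ne nexy by auto
  have inB: "x1 \<in> B" "y1 \<in> B" "z1 \<in> B" "z2 \<in> B" using xy1 xy2 z1 z2 by auto
  have two: "\<exists>c. list_colouring r B L c \<and> c z = d \<and> c z2 = d2"
    if "z \<in> {x1, y1}" "d \<in> L z" "d \<noteq> d2 \<or> \<not> r z z2" for z d
  proof -
    let ?f = "\<lambda>v. if v = z then d else d2"
    have zB: "z \<in> B" using that(1) inB by blast
    have "\<not> r z2 z" if "\<not> r z z2" using that sym by blast
    then have "list_colouring r {z, z2} L ?f"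
      using that z2 irr nez[OF that(1)] by (auto simp: list_colouring_def)
    then obtain c where "list_colouring r B L c" "\<forall>v \<in> {z, z2}. c v = ?f v"
      by (rule extend_partial[rotated]) (use inB zB in auto)
    then show ?thesis using nez[OF that(1)] by (intro exI[of _ c]) auto
  qed
  obtain c where c: "list_colouring r B L c" "c z1 = d1" "c z2 = d2"
    using two[OF z1(1) _ ok] z1(2) by blast
  have nez1: "z1 \<noteq> z2" using nez z1(1) by blast
  have "card Q + card {z1, z2} \<le> card (L q1 - c ` B) + 2"
    using inB q1 c z1 z2 by (intro saved') auto
  then have save_q1: "card Q \<le> card (L q1 - c ` B)" using nez1 by simp
  have save0: "card Q \<le> card (L q - c ` B) + 2" if "q \<in> Q" for q
    using saved'[of "{}" c q] that by simp
  \<comment> \<open>Hall's condition can only fail at \<open>Q - {q1}\<close>. Its union has then at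
    most \<open>card Q - 2\<close> colours, which each single remaining list there already reaches,
    so these lists agree and \<open>c\<close> wastes no colour on \<open>B\<close>.\<close>
  have fail: "card (\<Union>q' \<in> Q - {q1}. L q' - c ` B) + 2 \<le> card Q"
    using colouring_fails_saving_two[OF c(1) save0 q1 save_q1] by fastforce
  have tight: "L q = (\<Union>q' \<in> Q - {q1}. L q' - c ` B) \<union> c ` B \<and> card (c ` B) = card B"
    if q: "q \<in> Q" "q \<noteq> q1" for q
  proof -
    let ?W = "\<Union>q' \<in> Q - {q1}. L q' - c ` B"
    have sub: "L q - c ` B \<subseteq> ?W" using q by blast
    have finW: "finite ?W" by (rule finU) blast
    have "card (L q - c ` B) = card ?W"
      using fail save0[OF q(1)] card_mono[OF finW sub] by linarith
    then have W: "L q - c ` B = ?W" using finW sub by (intro card_subset_eq) auto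
    have "card (L q - c ` B) + 2 = card Q"
      using fail save0[OF q(1)] card_mono[OF finW sub] by linarith
    moreover have "card (L q) = card (L q - c ` B) + card (L q \<inter> c ` B)"
      using finL[OF q(1)] by (metis card_Diff_subset_Int card_mono finite_Int inf_le1 le_add_diff_inverse2)
    ultimately have "card (L q \<inter> c ` B) = card B" using card_Lq[OF q(1)] by linarith
    moreover have "card (L q \<inter> c ` B) \<le> card (c ` B)" using finB by (intro card_mono) auto
    moreover have "card (c ` B) \<le> card B" using finB by (rule card_image_le)
    ultimately have eq: "card (L q \<inter> c ` B) = card (c ` B)" "card (c ` B) = card B" by linarith+
    then have "L q \<inter> c ` B = c ` B" using finB by (intro card_subset_eq) auto
    then show ?thesis using W eq(2) by blast
  qed
  \<comment> \<open>All lists on \<open>Q\<close> but the one of \<open>q1\<close> coincide. Using a colour outside of them on the first pair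
    now saves one colour for every member of \<open>Q\<close>, and the union of all lists is large.\<close>
  obtain q2 where q2: "q2 \<in> Q" "q2 \<noteq> q1" using other by blast
  define \<Lambda> where "\<Lambda> = L q2"
  have \<Lambda>: "L q = \<Lambda>" if "q \<in> Q" "q \<noteq> q1" for q
    using tight[OF that] tight[OF q2] by (simp add: \<Lambda>_def)
  have "inj_on c B" using tight[OF q2] finB by (simp add: eq_card_imp_inj_on)
  then have d12: "d1 \<noteq> d2" using c nez1 inB by (metis inj_onD)
  have "c ` B \<subseteq> \<Lambda>" using tight[OF q2] by (auto simp: \<Lambda>_def)
  then have d_in: "{d1, d2} \<subseteq> \<Lambda>" using c inB by blast
  obtain d where d: "d \<in> L x1 \<union> L y1 - \<Lambda>"
    using missing_colours(2)[OF xy1 q2(1) dj] by (auto simp: \<Lambda>_def)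
  then obtain z where z: "z \<in> {x1, y1}" "d \<in> L z" by blast
  have "d \<noteq> d2" using d d_in by blast
  then obtain c' where c': "list_colouring r B L c'" "c' z = d" "c' z2 = d2"
    using two[OF z] by blast
  have zB: "z \<in> B" using z inB by blast
  have save1: "card Q \<le> card (L q - c' ` B) + 1" if q: "q \<in> Q" for q
  proof (cases "q = q1")
    case True
    have "card Q + card {z2} \<le> card (L q - c' ` B) + 2"
      using inB q c' z2 True by (intro saved') auto
    then show ?thesis by simp
  next
    case False
    have "card Q + card {z} \<le> card (L q - c' ` B) + 2"
      using zB q c' d \<Lambda>[OF q False] by (intro saved') auto
    then show ?thesis by simp
  qed
  \<comment> \<open>The distinct colours \<open>d1\<close> and \<open>d2\<close> lie in the common
    list but not in \<open>L q1\<close>, so the union of all lists has at least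
    \<open>card B + card Q\<close> colours.\<close>
  have "card (L q1) + 2 \<le> card (L q1 \<union> \<Lambda>)"
  proof -
    have "card (L q1 \<union> {d1, d2}) = card (L q1) + card {d1, d2}"
      using finL[OF q1] z1 z2 by (intro card_Un_disjoint) auto
    moreover have "card (L q1 \<union> {d1, d2}) \<le> card (L q1 \<union> \<Lambda>)"
      using d_in finL[OF q1] finL[OF q2(1)] by (intro card_mono) (auto simp: \<Lambda>_def)
    ultimately show ?thesis using d12 by simp
  qed
  moreover have "card (L q1 \<union> \<Lambda>) \<le> card (L q1 \<union> \<Lambda> - c' ` B) + card (c' ` B)"
    using diff_card_le_card_Diff[of "c' ` B" "L q1 \<union> \<Lambda>"] finB by simp
  moreover have "card (c' ` B) \<le> card B" using finB by (rule card_image_le)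
  moreover have "card (L q1 \<union> \<Lambda> - c' ` B) \<le> card (\<Union>q \<in> Q. L q - c' ` B)"
    using q1 q2 by (intro card_mono finU) (auto simp: \<Lambda>_def)
  ultimately have "card Q \<le> card (\<Union>q \<in> Q. L q - c' ` B)" using card_Lq[OF q1] by linarith
  then show False using colouring_fails_union[OF c'(1) save1] by blast
qed

text \<open>A colour missing from \<open>L q\<close> on one pair and a different one on the other
  pair would be two savings for \<open>q\<close>. So both pairs miss the same single colour, and the
  bound of \<open>missing_colours\<close> then leaves no room for a larger \<open>Q\<close> or for
  cross neighbours.\<close>

lemma disjoint_lists:
  assumes xy1: "x1 \<in> X" "y1 \<in> Y" "\<not> r x1 y1" and xy2: "x2 \<in> X" "y2 \<in> Y" "\<not> r x2 y2"
    and ne: "x1 \<noteq> x2" "y1 \<noteq> y2" and dj: "L x1 \<inter> L y1 = {}" "L x2 \<inter> L y2 = {}" and q: "q \<in> Q"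
  shows "card Q = 3 \<and> card {y \<in> Y. r x1 y} = 0 \<and> card {x \<in> X. r y1 x} = 0 \<and>
    card {y \<in> Y. r x2 y} = 0 \<and> card {x \<in> X. r y2 x} = 0 \<and> card (L x2) = card X + 1 \<and>
    (\<exists>d. d \<notin> L q \<and> L x1 \<union> L y1 = insert d (L q) \<and> L x2 \<union> L y2 = insert d (L q))"
proof -
  let ?D1 = "L x1 \<union> L y1 - L q" and ?D2 = "L x2 \<union> L y2 - L q"
  have all_eq: "d1 = d2" if "d1 \<in> ?D1" "d2 \<in> ?D2" for d1 d2
  proof (rule ccontr)
    assume "d1 \<noteq> d2"
    obtain z1 where z1: "z1 \<in> {x1, y1}" "d1 \<in> L z1 - L q" using \<open>d1 \<in> ?D1\<close> by blast
    obtain z2 where z2: "z2 \<in> {x2, y2}" "d2 \<in> L z2 - L q" using \<open>d2 \<in> ?D2\<close> by blast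
    show False
      using no_two_savings[OF xy1(1,2) xy2(1,2) ne dj(1) q z1 z2] \<open>d1 \<noteq> d2\<close> by blast
  qed
  note missing1 = missing_colours[OF xy1(1,2) q dj(1)] and missing2 = missing_colours[OF xy2(1,2) q dj(2)]
  obtain d where d: "d \<in> ?D1" using missing1(2) by blast
  have D: "?D2 = {d}" using all_eq[OF d] missing2(2) by blast
  then have D1: "?D1 = {d}" using all_eq d by blast
  have card_D: "card ?D1 = 1" "card ?D2 = 1" using D D1 by simp_all
  have zeros: "card Q = 3" "card {y \<in> Y. r x1 y} = 0" "card {x \<in> X. r y1 x} = 0"
    "card {y \<in> Y. r x2 y} = 0" "card {x \<in> X. r y2 x} = 0"
    using missing1(1) missing2(1) card_D card_Q by linarith+
  have full: "L x \<union> L y = insert d (L q) \<and> card (L x) = card X + 1"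
    if xy: "x \<in> X" "y \<in> Y" "L x \<inter> L y = {}" "L x \<union> L y - L q = {d}" for x y
  proof -
    have finU: "finite (L x)" "finite (L y)" using xy finL' by auto
    have 1: "card (L x \<union> L y) = card (L x) + card (L y)"
      using xy(3) finU by (intro card_Un_disjoint) auto
    have "card (L x \<union> L y) = card ((L x \<union> L y) \<inter> L q) + card (L x \<union> L y - L q)"
      using finU by (metis Int_Diff_Un Int_Diff_disjoint card_Un_disjoint finite_Diff finite_Int finite_UnI)
    then have 2: "card (L x \<union> L y) = card ((L x \<union> L y) \<inter> L q) + 1" using xy(4) by simp
    have 3: "card ((L x \<union> L y) \<inter> L q) \<le> card (L q)" using finL[OF q] by (intro card_mono) auto
    note sizes = card_LX[OF xy(1)] card_LY[OF xy(2)] card_Lq[OF q] card_B zeros(1)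
    have "card ((L x \<union> L y) \<inter> L q) = card (L q)" using 1 2 3 sizes by linarith
    then have "(L x \<union> L y) \<inter> L q = L q" using finL[OF q] by (intro card_subset_eq) auto
    then have "L x \<union> L y = insert d (L q)" using xy(4) by blast
    moreover have "card (L x) = card X + 1" using 1 2 3 sizes by linarith
    ultimately show ?thesis by blast
  qed
  have "d \<notin> L q" using d by blast
  then show ?thesis
    using zeros full[OF xy1(1,2) dj(1) D1] full[OF xy2(1,2) dj(2) D] by blast
qed

text \<open>The colour passes to the second pair and, as cross neighbours are excluded, to the
  crossed pair \<open>x1\<close>, \<open>y2\<close>. Both \<open>L x1\<close> and
  \<open>L x2\<close> then consist of \<open>a\<close> and the complement of \<open>L y2\<close> in
  \<open>L q\<close>.\<close>

lemma equal_lists_of_shared_colour: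
  assumes xy1: "x1 \<in> X" "y1 \<in> Y" "\<not> r x1 y1" and xy2: "x2 \<in> X" "y2 \<in> Y" "\<not> r x2 y2"
    and ne: "x1 \<noteq> x2" "y1 \<noteq> y2" and meet: "L x1 \<inter> L y1 \<noteq> {}"
  shows "card Q = 3 \<and> card {y \<in> Y. r x1 y} = 0 \<and> card {x \<in> X. r y1 x} = 0 \<and>
    card {y \<in> Y. r x2 y} = 0 \<and> card {x \<in> X. r y2 x} = 0 \<and> card (L x2) = card X + 1 \<and> L x1 = L x2"
proof -
  obtain q where q: "q \<in> Q" using other by blast
  obtain a where a: "a \<in> L x1" "a \<in> L y1" using meet by blast
  note s2 = shared_colour[OF xy1 xy2 ne a q]
  then have a2: "a \<in> L x2" "a \<in> L y2" by blast+
  note s1 = shared_colour[OF xy2 xy1 ne[symmetric] a2 q]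
  have n12: "\<not> r x1 y2" by (rule no_neighbour_X) (use s1 xy2 in simp_all)
  have n21: "\<not> r x2 y1" by (rule no_neighbour_X) (use s2 xy1 in simp_all)
  have s3: "L x1 \<union> L y2 = L q \<and> L x1 \<inter> L y2 = {a}"
    using shared_colour[OF xy2(1) xy1(2) n21 xy1(1) xy2(2) n12 ne(1)[symmetric] ne(2) a2(1) a(2) q]
    by blast
  have "L x2 \<union> L y2 = L q \<and> L x2 \<inter> L y2 = {a}" using s2 by blast
  with s3 have "L x1 = L x2" by blast
  then show ?thesis using s1 s2 by blast
qed

lemma equal_lists:
  assumes xy1: "x1 \<in> X" "y1 \<in> Y" "\<not> r x1 y1" and xy2: "x2 \<in> X" "y2 \<in> Y" "\<not> r x2 y2"
    and ne: "x1 \<noteq> x2" "y1 \<noteq> y2"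
  shows "card Q = 3 \<and> card {y \<in> Y. r x1 y} = 0 \<and> card {x \<in> X. r y1 x} = 0 \<and>
    card {y \<in> Y. r x2 y} = 0 \<and> card {x \<in> X. r y2 x} = 0 \<and> card (L x2) = card X + 1 \<and> L x1 = L x2"
proof (cases "L x1 \<inter> L y1 = {} \<and> L x2 \<inter> L y2 = {}")
  case True
  obtain q where q: "q \<in> Q" using other by blast
  note dj = disjoint_lists[OF xy1 xy2 ne conjunct1[OF True] conjunct2[OF True] q]
  have n12: "\<not> r x1 y2" by (rule no_neighbour_X) (use dj xy2 in simp_all)
  have n21: "\<not> r x2 y1" by (rule no_neighbour_X) (use dj xy1 in simp_all)
  \<comment> \<open>The crossed pairs are nonadjacent as well. If their lists are disjoint too, the
    extra colour is again \<open>d\<close>, and both lists are the complement of \<open>L y1\<close>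
    in \<open>insert d (L q)\<close>.\<close>
  have "L x1 = L x2"
  proof (cases "L x1 \<inter> L y2 = {} \<and> L x2 \<inter> L y1 = {}")
    case cross: True
    obtain d where d: "d \<notin> L q" "L x1 \<union> L y1 = insert d (L q)" "L x2 \<union> L y2 = insert d (L q)"
      using dj by blast
    obtain d' where d': "L x1 \<union> L y2 = insert d' (L q)" "L x2 \<union> L y1 = insert d' (L q)"
      using disjoint_lists[OF xy1(1) xy2(2) n12 xy2(1) xy1(2) n21 ne(1) ne(2)[symmetric]
        conjunct1[OF cross] conjunct2[OF cross] q] by blast
    have "d \<in> L x1 \<union> L y1" using d(2) by blast
    then have "d \<in> insert d' (L q)" using d' by blast
    then have "d' = d" using d(1) by blast
    then show ?thesis using d d' True cross by blast
  next
    case False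
    then show ?thesis
      using equal_lists_of_shared_colour[OF xy1(1) xy2(2) n12 xy2(1) xy1(2) n21 ne(1) ne(2)[symmetric]]
        equal_lists_of_shared_colour[OF xy2(1) xy1(2) n21 xy1(1) xy2(2) n12 ne(1)[symmetric] ne(2)]
      by blast
  qed
  then show ?thesis using dj by blast
next
  case False
  then consider "L x1 \<inter> L y1 \<noteq> {}" | "L x2 \<inter> L y2 \<noteq> {}" by blast
  then show ?thesis
  proof cases
    case 1
    then show ?thesis by (rule equal_lists_of_shared_colour[OF xy1 xy2 ne])
  next
    case 2
    from equal_lists_of_shared_colour[OF xy2 xy1 ne[symmetric] this] show ?thesis by auto
  qed
qed

text \<open>As \<open>y2\<close> has no neighbour in \<open>X\<close>, every \<open>x\<close> other
  than \<open>x1\<close> forms with it a nonadjacent pair disjoint from \<open>x1\<close>,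
  \<open>y1\<close>, so the equality of two lists spreads to all of \<open>X\<close>.\<close>

lemma rigid_of_two_pairs:
  assumes xy1: "x1 \<in> X" "y1 \<in> Y" "\<not> r x1 y1" and xy2: "x2 \<in> X" "y2 \<in> Y" "\<not> r x2 y2"
    and ne: "x1 \<noteq> x2" "y1 \<noteq> y2"
  shows "card Q = 3 \<and> (\<forall>x \<in> X. \<forall>y \<in> Y. \<not> r x y) \<and> (\<exists>A. card A = card X + 1 \<and> (\<forall>x \<in> X. L x = A))"
proof -
  note e = equal_lists[OF xy1 xy2 ne]
  have *: "card {y \<in> Y. r x y} = 0 \<and> L x = L x1" if x: "x \<in> X" for x
  proof (cases "x = x1")
    case True
    then show ?thesis using e by simp
  next
    case False
    have "\<not> r x y2" by (rule no_neighbour_Y) (use e x in simp_all)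
    from equal_lists[OF xy1 x xy2(2) this False[symmetric] ne(2)] show ?thesis by simp
  qed
  have "\<not> r x y" if "x \<in> X" "y \<in> Y" for x y
    by (rule no_neighbour_X) (use *[OF that(1)] that in simp_all)
  moreover have "card Q = 3" "card (L x1) = card X + 1" using e by simp_all
  moreover have "L x = L x1" if "x \<in> X" for x using *[OF that] by simp
  ultimately show ?thesis by (intro conjI exI[of _ "L x1"]) simp_all
qed

end

end

section \<open>Minimal uncolourable sets of edges\<close>

definition adjacent :: "('e \<Rightarrow> 'v set) \<Rightarrow> 'e \<Rightarrow> 'e \<Rightarrow> bool" where
  "adjacent en e f \<longleftrightarrow> e \<noteq> f \<and> en e \<inter> en f \<noteq> {}"

lemma adjacent_sym: "adjacent en e f \<Longrightarrow> adjacent en f e"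
  by (auto simp: adjacent_def)

lemma adjacent_irrefl: "\<not> adjacent en e e"
  by (simp add: adjacent_def)

text \<open>The conditions \<open>max_degree\<close> and \<open>no_clique\<close> express that
  \<open>k\<close> is at least the maximum degree minus one and the clique number of the line graph.
  The minimum degree concerns all edges \<open>E\<close>, whereas the notions below count only edges
  of \<open>S\<close>.\<close>

locale critical_edges =
  fixes en :: "'e \<Rightarrow> 'v set" and E S :: "'e set" and L :: "'e \<Rightarrow> 'c set" and k :: nat
  assumes finE: "finite E" and card_en: "e \<in> E \<Longrightarrow> card (en e) = 2" and S_sub: "S \<subseteq> E"
    and min_degree: "\<lbrakk>e \<in> E; v \<in> en e\<rbrakk> \<Longrightarrow> 7 \<le> card {f \<in> E. v \<in> en f}"
    and max_degree: "e \<in> E \<Longrightarrow> card {f \<in> E. adjacent en e f} \<le> k + 1"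
    and no_clique: "\<lbrakk>K \<subseteq> E; \<And>e f. \<lbrakk>e \<in> K; f \<in> K; e \<noteq> f\<rbrakk> \<Longrightarrow> adjacent en e f\<rbrakk> \<Longrightarrow> card K \<le> k"
    and L: "e \<in> E \<Longrightarrow> finite (L e) \<and> card (L e) = k"
    and not_colourable: "\<not> list_colouring (adjacent en) S L c"
    and critical: "T \<subset> S \<Longrightarrow> \<exists>c. list_colouring (adjacent en) T L c"
begin

abbreviation "adj \<equiv> adjacent en"

definition star :: "'v \<Rightarrow> 'e set" where "star v = {f \<in> S. v \<in> en f}"

definition deg :: "'v \<Rightarrow> nat" where "deg v = card (star v)"

definition nb :: "'e \<Rightarrow> 'e set" where "nb e = {f \<in> S. adj e f}"

definition par :: "'e \<Rightarrow> 'e set" where "par e = {f \<in> S. en f = en e}"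

text \<open>By \<open>nb_ge\<close> and \<open>nb_le\<close> this is 0 or 1. It also bounds the
  number of edges of \<open>E - S\<close> next to \<open>e\<close>, so it measures both the spare
  colour at \<open>e\<close> and the possible loss of degree at its ends.\<close>

definition slack :: "'e \<Rightarrow> nat" where "slack e = k + 1 - card (nb e)"

lemma finS: "finite S" using S_sub finE finite_subset by blast

lemma fin [simp]: "finite (star v)" "finite (nb e)" "finite (par e)"
  using finS by (simp_all add: star_def nb_def par_def)

lemma ends_cases:
  assumes "e \<in> S" "u \<in> en e"
  obtains v where "en e = {u, v}" "u \<noteq> v"
proof -
  have "card (en e) = 2" using card_en S_sub assms(1) by blast
  then obtain a b where "en e = {a, b}" "a \<noteq> b" by (auto simp: card_2_iff)
  then show ?thesis using that assms(2) by (metis insert_commute insertE singletonD)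
qed

lemma nb_le: "e \<in> S \<Longrightarrow> card (nb e) \<le> k + 1"
proof -
  assume e: "e \<in> S"
  have "card (nb e) \<le> card {f \<in> E. adj e f}"
    using S_sub finE by (intro card_mono) (auto simp: nb_def)
  then show ?thesis using max_degree[of e] e S_sub by fastforce
qed

lemma nb_ge:
  assumes e: "e \<in> S"
  shows "k \<le> card (nb e)"
proof (rule ccontr)
  assume less: "\<not> ?thesis"
  obtain c where c: "list_colouring adj (S - {e}) L c" using critical[of "S - {e}"] e by blast
  have "card {f \<in> S. adj x f} < card (L x)" if "x \<in> S - (S - {e})" for x
    using that less L[of e] e S_sub by (auto simp: nb_def)
  from greedy_extension[OF finS adjacent_sym adjacent_irrefl _ c this] show False
    using not_colourable by blast
qed

lemma slack: "e \<in> S \<Longrightarrow> card (nb e) + slack e = k + 1" "e \<in> S \<Longrightarrow> slack e \<le> 1"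
  using nb_le[of e] nb_ge[of e] by (simp_all add: slack_def)

lemma in_par: "e \<in> S \<Longrightarrow> e \<in> par e" by (simp add: par_def)

lemma par_sub: "u \<in> en e \<Longrightarrow> par e \<subseteq> star u" by (auto simp: par_def star_def)

lemma degree_sum:
  assumes e: "e \<in> S" "en e = {x, y}" "x \<noteq> y"
  shows "deg x + deg y + slack e = k + 2 + card (par e)"
proof -
  have "star x \<union> star y = insert e (nb e)"
    using e by (auto simp: star_def nb_def adjacent_def)
  moreover have "star x \<inter> star y = par e"
  proof
    show "star x \<inter> star y \<subseteq> par e"
    proof
      fix f assume f: "f \<in> star x \<inter> star y"
      then have "en e \<subseteq> en f" "f \<in> S" using e(2) by (auto simp: star_def)
      moreover have "card (en f) = card (en e)" "finite (en f)"
        using card_en S_sub e(1) \<open>f \<in> S\<close> by (metis subset_iff, metis card.infinite subset_iff zero_neq_numeral)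
      ultimately have "en e = en f" by (metis card_subset_eq)
      then show "f \<in> par e" using \<open>f \<in> S\<close> by (simp add: par_def)
    qed
  qed (use e par_sub[of x e] par_sub[of y e] in auto)
  moreover have "e \<notin> nb e" by (simp add: nb_def adjacent_def)
  ultimately have "deg x + deg y = Suc (card (nb e)) + card (par e)"
    using card_Un_Int[of "star x" "star y"] by (simp add: deg_def)
  then show ?thesis using slack(1)[OF e(1)] by simp
qed

lemma missing_edges:
  assumes e: "e \<in> S"
  shows "card {f \<in> E - S. adj e f} \<le> slack e"
proof -
  have "{f \<in> E. adj e f} = nb e \<union> {f \<in> E - S. adj e f}" using S_sub by (auto simp: nb_def)
  moreover have "card (nb e \<union> {f \<in> E - S. adj e f}) = card (nb e) + card {f \<in> E - S. adj e f}"
    using finE finS by (intro card_Un_disjoint) (auto simp: nb_def)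
  ultimately show ?thesis using max_degree[of e] e S_sub slack(1)[OF e] by fastforce
qed

lemma degree_E:
  assumes e: "e \<in> S" "v \<in> en e"
  shows "7 \<le> deg v + card {f \<in> E - S. v \<in> en f}"
proof -
  have "{f \<in> E. v \<in> en f} = star v \<union> {f \<in> E - S. v \<in> en f}" using S_sub by (auto simp: star_def)
  moreover have "card (star v \<union> {f \<in> E - S. v \<in> en f}) = deg v + card {f \<in> E - S. v \<in> en f}"
    unfolding deg_def using finE finS by (intro card_Un_disjoint) (auto simp: star_def)
  ultimately show ?thesis using min_degree[of e v] e S_sub by fastforce
qed

lemma degree_ge:
  assumes e: "e \<in> S" "v \<in> en e"
  shows "7 \<le> deg v + slack e"
proof -
  have "card {f \<in> E - S. v \<in> en f} \<le> card {f \<in> E - S. adj e f}"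
    using e finE by (intro card_mono) (auto simp: adjacent_def)
  then show ?thesis using degree_E[OF e] missing_edges[OF e(1)] by linarith
qed

section \<open>Residual lists and classes of at least three parallel edges\<close>

definition residual :: "'e set \<Rightarrow> ('e \<Rightarrow> 'c) \<Rightarrow> 'e \<Rightarrow> 'c set" where
  "residual F c h = L h - c ` {g \<in> S - F. adj h g}"

lemma residual_iff: "d \<in> residual F c h \<longleftrightarrow> d \<in> L h \<and> (\<forall>g \<in> S - F. adj h g \<longrightarrow> c g \<noteq> d)"
  unfolding residual_def by blast

lemma residual_not_colourable:
  assumes F: "F \<subseteq> S" and c0: "list_colouring adj (S - F) L c0"
  shows "\<not> list_colouring adj F (residual F c0) c"
proof
  assume c: "list_colouring adj F (residual F c0) c"
  let ?c = "\<lambda>x. if x \<in> F then c x else c0 x"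
  have "list_colouring adj S L ?c"
    unfolding list_colouring_def
  proof (intro conjI ballI impI)
    have cF: "c x \<in> residual F c0 x" if "x \<in> F" for x
      using c that by (simp add: list_colouring_def)
    have c0F: "c0 x \<in> L x" if "x \<in> S" "x \<notin> F" for x
      using c0 that by (simp add: list_colouring_def)
    show "?c x \<in> L x" if "x \<in> S" for x
      using cF c0F[OF that] by (simp add: residual_iff)
    fix x y assume xy: "x \<in> S" "y \<in> S" "adj x y"
    have cross: "c0 w \<noteq> c z" if "z \<in> F" "w \<in> S" "w \<notin> F" "adj z w" for z w
      using cF[OF that(1)] that(2-4) by (simp add: residual_iff)
    have "c x \<noteq> c y" if "x \<in> F" "y \<in> F"
      using c that xy(3) by (simp add: list_colouring_def)
    moreover have "c0 x \<noteq> c0 y" if "x \<notin> F" "y \<notin> F"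
      using c0 that xy by (simp add: list_colouring_def)
    ultimately show "?c x \<noteq> ?c y"
      using cross[of x y] cross[of y x] xy adjacent_sym[OF xy(3)] by auto
  qed
  then show False using not_colourable by blast
qed

lemma card_residual:
  assumes F: "F \<subseteq> S" and h: "h \<in> S"
  shows "k + card {g \<in> F. adj h g} \<le> card (residual F c h) + card (nb h)"
proof -
  let ?N = "{g \<in> S - F. adj h g}"
  have "nb h = {g \<in> F. adj h g} \<union> ?N" using F by (auto simp: nb_def)
  then have "card (nb h) = card ({g \<in> F. adj h g} \<union> ?N)" by simp
  also have "\<dots> = card {g \<in> F. adj h g} + card ?N"
    using finS finite_subset[OF F finS] by (intro card_Un_disjoint) auto
  finally have "card (nb h) = card {g \<in> F. adj h g} + card ?N" .
  moreover have "card (L h) - card (c ` ?N) \<le> card (residual F c h)"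
    unfolding residual_def using finS by (intro diff_card_le_card_Diff) auto
  moreover have "card (c ` ?N) \<le> card ?N" using finS by (intro card_image_le) auto
  moreover have "card (L h) = k" using L h S_sub by blast
  ultimately show ?thesis by linarith
qed

text \<open>Koenig's theorem in its smallest case: if no two nonadjacent pairs are disjoint, they
  form a star. Deleting its centre from the two cliques leaves one clique.\<close>

lemma clique_pair_cover:
  fixes X Y :: "'e set"
  assumes "\<And>x1 y1 x2 y2. \<lbrakk>x1 \<in> X; y1 \<in> Y; \<not> adj x1 y1; x2 \<in> X; y2 \<in> Y; \<not> adj x2 y2\<rbrakk> \<Longrightarrow> x1 = x2 \<or> y1 = y2"
    and "x0 \<in> X" "y0 \<in> Y" "\<not> adj x0 y0"
  shows "\<exists>z \<in> X \<union> Y. \<forall>x \<in> X. \<forall>y \<in> Y. \<not> adj x y \<longrightarrow> x = z \<or> y = z"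
proof (cases "\<forall>x \<in> X. \<forall>y \<in> Y. \<not> adj x y \<longrightarrow> x = x0")
  case True
  then show ?thesis using assms(2) by blast
next
  case False
  then obtain x2 y2 where 2: "x2 \<in> X" "y2 \<in> Y" "\<not> adj x2 y2" "x2 \<noteq> x0" by blast
  then have "y2 = y0" using assms by metis
  have "y = y0" if "x \<in> X" "y \<in> Y" "\<not> adj x y" for x y
    using assms(1)[OF that assms(2-4)] assms(1)[OF that 2(1-3)] 2(4) \<open>y2 = y0\<close> by metis
  then show ?thesis using assms(3) by blast
qed

text \<open>With \<open>Q = par e\<close> the residual lists form a clique pair, and the lists on
  \<open>Q\<close> are untouched because all neighbours of \<open>e\<close> lie in \<open>F\<close>.
  If \<open>slack e = 1\<close>, then \<open>card F = k + 1\<close>, so \<open>F\<close> is no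
  clique and has a nonadjacent pair. If \<open>slack e = 0\<close>, then
  \<open>card F = k + 2\<close>, so even \<open>F\<close> without one edge is no clique, which gives
  two disjoint pairs. The list size \<open>k\<close> matches the required one in either
  case.\<close>

lemma rigid:
  assumes e: "e \<in> S" "en e = {u, v}" "u \<noteq> v" and par: "3 \<le> card (par e)"
    and F: "F = star u \<union> star v" and X: "X = star u - par e" and Y: "Y = star v - par e"
    and c0: "list_colouring adj (S - F) L c0"
  shows "card (par e) = 3 \<and> (\<forall>x \<in> X. \<forall>y \<in> Y. \<not> adj x y) \<and>
    (\<exists>A. card A = card X + 1 \<and> (\<forall>x \<in> X. residual F c0 x = A))"
proof -
  let ?Q = "par e" and ?L = "residual F c0"
  have Q_sub: "?Q \<subseteq> star u" "?Q \<subseteq> star v" using par_sub[of _ e] e(2) by auto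
  have FS: "F \<subseteq> S" by (auto simp: F star_def)
  have F_eq: "F = ?Q \<union> X \<union> Y" using Q_sub by (auto simp: F X Y)
  have inter: "star u \<inter> star v \<subseteq> ?Q"
  proof
    fix f assume f: "f \<in> star u \<inter> star v"
    then obtain w where "en f = {u, w}" "u \<noteq> w" using ends_cases[of f u] by (auto simp: star_def)
    then show "f \<in> ?Q" using f e by (auto simp: star_def par_def)
  qed
  then have XY: "X \<inter> Y = {}" by (auto simp: X Y)
  have Q_in: "u \<in> en q \<and> v \<in> en q" if "q \<in> ?Q" for q using that e(2) by (auto simp: par_def)
  have adjQ: "adj q z" if "q \<in> ?Q" "z \<in> F" "q \<noteq> z" for q z
    using that Q_in[OF that(1)] by (auto simp: F adjacent_def star_def)
  have cl: "adj x x'" if "x \<in> star w" "x' \<in> star w" "x \<noteq> x'" for x x' w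
    using that by (auto simp: adjacent_def star_def)
  interpret clique_pair adj ?Q X Y ?L
  proof (unfold_locales)
    show "adj y x" if "adj x y" for x y using that by (rule adjacent_sym)
    show "\<not> adj x x" for x by (rule adjacent_irrefl)
    show "finite ?Q" "finite X" "finite Y" by (simp_all add: X Y)
    show "?Q \<inter> X = {}" "?Q \<inter> Y = {}" by (auto simp: X Y)
    show "X \<inter> Y = {}" by (rule XY)
    show "3 \<le> card ?Q" by (rule par)
    show "adj x x'" if "x \<in> X" "x' \<in> X" "x \<noteq> x'" for x x' using that cl[of x u x'] by (simp add: X)
    show "adj x x'" if "x \<in> Y" "x' \<in> Y" "x \<noteq> x'" for x x' using that cl[of x v x'] by (simp add: Y)
    show "card {z \<in> X \<union> Y. adj x z} + card ?Q \<le> card (?L x) + 1" if x: "x \<in> X \<union> Y" for x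
    proof -
      have xS: "x \<in> S" "x \<in> F" "x \<notin> ?Q" using x by (auto simp: X Y F star_def)
      have "adj x q" if q: "q \<in> ?Q" for q
        using adjacent_sym[OF adjQ[OF q xS(2)]] q xS(3) by blast
      then have "{g \<in> F. adj x g} = {z \<in> X \<union> Y. adj x z} \<union> ?Q"
        unfolding F_eq by blast
      then have "card {g \<in> F. adj x g} = card ({z \<in> X \<union> Y. adj x z} \<union> ?Q)" by simp
      also have "card ({z \<in> X \<union> Y. adj x z} \<union> ?Q) = card {z \<in> X \<union> Y. adj x z} + card ?Q"
        by (intro card_Un_disjoint) (auto simp: X Y)
      finally show ?thesis using card_residual[OF FS xS(1), of c0] nb_le[OF xS(1)] by linarith
    qed
    show "finite (?L q)" if "q \<in> ?Q" for q
      using L[of q] that S_sub by (auto simp: residual_def par_def)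
    show "\<not> list_colouring adj (?Q \<union> X \<union> Y) ?L c" for c
      using residual_not_colourable[OF FS c0] F_eq by simp
  qed
  have adjF: "adj f g" if fg: "f \<in> F" "g \<in> F" "f \<noteq> g"
    and XY: "\<lbrakk>f \<in> X; g \<in> Y\<rbrakk> \<Longrightarrow> adj f g" and YX: "\<lbrakk>g \<in> X; f \<in> Y\<rbrakk> \<Longrightarrow> adj g f" for f g
  proof -
    have "f \<in> ?Q \<or> f \<in> X \<or> f \<in> Y" "g \<in> ?Q \<or> g \<in> X \<or> g \<in> Y" using fg(1,2) unfolding F_eq by simp_all
    then consider "f \<in> ?Q" | "g \<in> ?Q" | "f \<in> X" "g \<in> X" | "f \<in> Y" "g \<in> Y"
      | "f \<in> X" "g \<in> Y" | "g \<in> X" "f \<in> Y" by argo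
    then show ?thesis
    proof cases
      case 1
      then show ?thesis using adjQ fg by simp
    next
      case 2
      then show ?thesis using adjacent_sym[OF adjQ[OF 2 fg(1)]] fg(3) by simp
    next
      case 6
      then show ?thesis using adjacent_sym[OF YX] by simp
    qed (use clX clY XY fg(3) in simp_all)
  qed
  have eF: "e \<in> ?Q" using in_par e(1) .
  have card_F: "card F = card ?Q + card (X \<union> Y)"
    unfolding F_eq Un_assoc by (intro card_Un_disjoint) (auto simp: X Y)
  have nbF: "insert q (nb q) = F" if "q \<in> ?Q" for q
    using that e by (auto simp: F par_def nb_def star_def adjacent_def)
  have card_nb: "card (nb q) + 1 = card F" if "q \<in> ?Q" for q
    using nbF[OF that] by (metis Suc_eq_plus1 adjacent_irrefl card_insert_disjoint fin(2) mem_Collect_eq nb_def)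
  have Lq: "?L q = L q" if "q \<in> ?Q" for q using nbF[OF that] by (auto simp: residual_def nb_def)
  have card_Lq: "card (?L q) = k" if "q \<in> ?Q" for q
    using Lq[OF that] L[of q] that S_sub by (auto simp: par_def)
  have F_E: "F \<subseteq> E" using FS S_sub by blast
  have finF: "finite F" using F_E finE finite_subset by blast
  show ?thesis
  proof (cases "slack e = 0")
    case False
    then have "card (nb e) = k" using slack[OF e(1)] by simp
    then have k: "card F = k + 1" using card_nb[OF eF] by simp
    have "\<exists>x \<in> X. \<exists>y \<in> Y. \<not> adj x y"
    proof (rule ccontr)
      assume neg: "\<not> ?thesis"
      have "adj f g" if "f \<in> F" "g \<in> F" "f \<noteq> g" for f g
        by (rule adjF[OF that]) (use neg in simp_all)
      then have "card F \<le> k" by (rule no_clique[OF F_E])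
      then show False using k by simp
    qed
    then obtain x0 y0 where "x0 \<in> X" "y0 \<in> Y" "\<not> adj x0 y0" by blast
    moreover have "card (?L q) + 1 = card (X \<union> Y) + card ?Q" if "q \<in> ?Q" for q
      using card_Lq[OF that] k card_F by simp
    ultimately show ?thesis by (intro rigid_of_one_pair)
  next
    case True
    then have "card (nb e) = k + 1" using slack[OF e(1)] by simp
    then have k: "card F = k + 2" using card_nb[OF eF] by simp
    have "\<exists>x1 y1 x2 y2. x1 \<in> X \<and> y1 \<in> Y \<and> \<not> adj x1 y1 \<and> x2 \<in> X \<and> y2 \<in> Y \<and> \<not> adj x2 y2 \<and> x1 \<noteq> x2 \<and> y1 \<noteq> y2"
    proof (rule ccontr)
      assume neg: "\<not> ?thesis"
      then have cover: "x1 = x2 \<or> y1 = y2" if "x1 \<in> X" "y1 \<in> Y" "\<not> adj x1 y1" "x2 \<in> X" "y2 \<in> Y" "\<not> adj x2 y2"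
        for x1 y1 x2 y2 using that by blast
      have "\<exists>z. \<forall>x \<in> X. \<forall>y \<in> Y. \<not> adj x y \<longrightarrow> x = z \<or> y = z"
      proof (cases "\<exists>x \<in> X. \<exists>y \<in> Y. \<not> adj x y")
        case True
        then obtain x0 y0 where 0: "x0 \<in> X" "y0 \<in> Y" "\<not> adj x0 y0" by blast
        show ?thesis using clique_pair_cover[OF cover 0] by blast
      qed blast
      then obtain z where z: "\<And>x y. x \<in> X \<Longrightarrow> y \<in> Y \<Longrightarrow> \<not> adj x y \<Longrightarrow> x = z \<or> y = z" by blast
      have "adj f g" if fg: "f \<in> F - {z}" "g \<in> F - {z}" "f \<noteq> g" for f g
      proof (rule adjF)
        show "adj f g" if "f \<in> X" "g \<in> Y" using z[OF that] fg by auto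
        show "adj g f" if "g \<in> X" "f \<in> Y" using z[OF that] fg by auto
      qed (use fg in simp_all)
      then have "card (F - {z}) \<le> k" by (intro no_clique) (use F_E in auto)
      moreover have "card F \<le> card (F - {z}) + 1"
        using diff_card_le_card_Diff[of "{z}" F] by simp
      ultimately show False using k by simp
    qed
    then obtain x1 y1 x2 y2 where "x1 \<in> X" "y1 \<in> Y" "\<not> adj x1 y1" "x2 \<in> X" "y2 \<in> Y" "\<not> adj x2 y2"
      "x1 \<noteq> x2" "y1 \<noteq> y2" by blast
    moreover have "card (?L q) + 2 = card (X \<union> Y) + card ?Q" if "q \<in> ?Q" for q
      using card_Lq[OF that] k card_F by simp
    ultimately show ?thesis by (intro rigid_of_two_pairs)
  qed
qed

lemma triple:
  assumes e: "e \<in> S" "en e = {u, v}" "u \<noteq> v" and par: "3 \<le> card (par e)"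
  shows "card (par e) = 3"
    and "\<lbrakk>x \<in> star u - par e; y \<in> star v - par e\<rbrakk> \<Longrightarrow> \<not> adj x y"
proof -
  have "S - (star u \<union> star v) \<subset> S" using e by (auto simp: star_def)
  then obtain c0 where "list_colouring adj (S - (star u \<union> star v)) L c0" using critical by blast
  from rigid[OF e par refl refl refl this]
  show "card (par e) = 3" "\<lbrakk>x \<in> star u - par e; y \<in> star v - par e\<rbrakk> \<Longrightarrow> \<not> adj x y" by blast+
qed

text \<open>
  Recolouring one edge \<open>h\<close> next to \<open>f\<close> changes the remaining list of \<open>f\<close>, but not the one of \<open>g\<close>;
  by \<open>rigid\<close>, however, both lists have to agree for either colour of \<open>h\<close>.
\<close>

lemma two_triples:
  assumes e: "e \<in> S" "en e = {u, v}" "u \<noteq> v" "3 \<le> card (par e)"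
    and f: "f \<in> S" "en f = {u, y}" "u \<noteq> y" "3 \<le> card (par f)" and vy: "v \<noteq> y"
    and g: "g \<in> star u" "g \<notin> par e" "g \<notin> par f"
  shows False
proof -
  have par3: "card (par e) = 3" "card (par f) = 3" using triple(1) e f by blast+
  have "7 \<le> deg y + slack f" using degree_ge[OF f(1)] f(2) by simp
  then have "card (par f) < card (star y)" using slack(2)[OF f(1)] par3 by (simp add: deg_def)
  then have "\<not> star y \<subseteq> par f" using card_mono[of "par f" "star y"] by fastforce
  \<comment> \<open>The edge to be recoloured: \<open>y\<close> has degree at least 6 in
    \<open>S\<close>, but \<open>par f\<close> has only three edges.\<close>
  then obtain h where h: "h \<in> star y" "h \<notin> par f" by blast
  have hS: "h \<in> S" "y \<in> en h" using h by (simp_all add: star_def)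
  obtain z where z: "en h = {y, z}" "y \<noteq> z" using ends_cases[OF hS] .
  define F X where "F = star u \<union> star v" and "X = star u - par e"
  have f_X: "f \<in> X" using f vy e by (auto simp: X_def star_def par_def doubleton_eq_iff)
  have g_X: "g \<in> X" using g by (simp add: X_def)
  have "z \<noteq> u" using h z hS f by (auto simp: par_def insert_commute)
  have "z \<noteq> v"
  proof
    assume "z = v"
    then have "h \<in> star v - par e" using z hS e f vy by (auto simp: star_def par_def)
    moreover have "adj f h" using f z h hS in_par[OF f(1)] by (auto simp: adjacent_def)
    ultimately show False using triple(2)[OF e] f_X by (auto simp: X_def)
  qed
  have h_F: "h \<notin> F" using z \<open>z \<noteq> u\<close> \<open>z \<noteq> v\<close> f(3) vy by (auto simp: F_def star_def)
  have FS: "F \<subseteq> S" by (auto simp: F_def star_def)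
  have adj_fh: "adj f h" using f z h hS in_par[OF f(1)] by (auto simp: adjacent_def)
  have nadj_gh: "\<not> adj g h" using triple(2)[OF f, of g h] g h by blast
  have "S - insert h F \<subset> S" using hS by blast
  then obtain c0 where c0: "list_colouring adj (S - insert h F) L c0" using critical by blast
  let ?R = "residual (insert h F) c0"
  have h_par: "par f \<subseteq> {g \<in> insert h F. adj h g}"
    using f hS h by (auto simp: par_def F_def star_def adjacent_def)
  have fin': "finite {g \<in> insert h F. adj x g}" for x using FS finS finite_subset by fastforce
  \<comment> \<open>Three uncoloured neighbours in \<open>par f\<close> leave at least two colours
    for \<open>h\<close>.\<close>
  have "3 \<le> card {g \<in> insert h F. adj h g}" using card_mono[OF fin' h_par] par3 by simp
  moreover have "insert h F \<subseteq> S" using FS hS by blast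
  ultimately have "2 \<le> card (?R h)"
    using card_residual[of "insert h F" h c0] hS(1) nb_le[OF hS(1)] by fastforce
  then have "\<not> card (?R h) \<le> Suc 0" by simp
  moreover from this have "finite (?R h)" by (intro card_ge_0_finite) simp
  ultimately obtain \<alpha> \<beta> where ab: "\<alpha> \<in> ?R h" "\<beta> \<in> ?R h" "\<alpha> \<noteq> \<beta>"
    using card_le_Suc0_iff_eq by metis
  have S_h: "S - F = insert h (S - insert h F)" using hS h_F by blast
  have ext: "list_colouring adj (S - F) L (c0(h := a))" if a: "a \<in> ?R h" for a
    unfolding list_colouring_def
  proof (intro conjI ballI impI)
    show "(c0(h := a)) x \<in> L x" if "x \<in> S - F" for x
      using c0 a that by (auto simp: list_colouring_def residual_def)
    fix x w assume xw: "x \<in> S - F" "w \<in> S - F" "adj x w"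
    have new: "a \<noteq> c0 t" if "t \<in> S - insert h F" "adj h t" for t
      using a that by (auto simp: residual_def)
    have old: "c0 x \<noteq> c0 w" if "x \<noteq> h" "w \<noteq> h"
      using c0 xw that unfolding list_colouring_def by blast
    show "(c0(h := a)) x \<noteq> (c0(h := a)) w"
      using new[of x] new[of w] old xw adjacent_sym[OF xw(3)] adjacent_irrefl[of en]
      by (cases "x = h"; cases "w = h") auto
  qed
  have res: "residual F (c0(h := a)) x = ?R x - (if adj x h then {a} else {})" for x a
  proof (rule set_eqI)
    fix d
    have "(\<forall>t \<in> S - F. adj x t \<longrightarrow> (c0(h := a)) t \<noteq> d) \<longleftrightarrow>
        (adj x h \<longrightarrow> a \<noteq> d) \<and> (\<forall>t \<in> S - insert h F. adj x t \<longrightarrow> c0 t \<noteq> d)"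
      unfolding S_h by simp
    then have l: "d \<in> residual F (c0(h := a)) x \<longleftrightarrow>
        d \<in> L x \<and> (adj x h \<longrightarrow> a \<noteq> d) \<and> (\<forall>t \<in> S - insert h F. adj x t \<longrightarrow> c0 t \<noteq> d)"
      by (simp only: residual_iff)
    have r: "d \<in> ?R x \<longleftrightarrow> d \<in> L x \<and> (\<forall>t \<in> S - insert h F. adj x t \<longrightarrow> c0 t \<noteq> d)"
      by (rule residual_iff)
    show "d \<in> residual F (c0(h := a)) x \<longleftrightarrow> d \<in> ?R x - (if adj x h then {a} else {})"
      by (cases "adj x h") (auto simp only: Diff_iff l r if_True if_False)
  qed
  have XF: "X \<subseteq> F" by (auto simp: X_def F_def)
  have const: "card (?R f - {a}) = card X + 1 \<and> ?R f - {a} = ?R g" if a: "a \<in> ?R h" for a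
  proof -
    obtain A where A: "card A = card X + 1" "\<And>x. x \<in> X \<Longrightarrow> residual F (c0(h := a)) x = A"
      using rigid[OF e F_def X_def refl ext[OF a]] by blast
    then show ?thesis
      using A(2)[OF f_X] A(2)[OF g_X] adj_fh nadj_gh unfolding res by simp
  qed
  have "?R f - {\<alpha>} = ?R f - {\<beta>}" using const[OF ab(1)] const[OF ab(2)] by simp
  then have "\<alpha> \<notin> ?R f" using ab(3) by blast
  then have "?R f - {\<alpha>} = ?R f" by blast
  then have card_Rf: "card (?R f) = card X + 1" using const[OF ab(1)] by metis
  \<comment> \<open>The edge \<open>f\<close> has \<open>card X + 3\<close> uncoloured neighbours,
    so its list keeps at least \<open>card X + 2\<close> colours, one more than rigidity
    allows.\<close>
  have "insert h (par e) \<union> (X - {f}) \<subseteq> {t \<in> insert h F. adj f t}"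
    using e f f_X adj_fh by (auto simp: X_def F_def star_def par_def adjacent_def)
  from card_mono[OF fin' this]
  have "card (insert h (par e) \<union> (X - {f})) \<le> card {t \<in> insert h F. adj f t}" .
  moreover have "card (insert h (par e) \<union> (X - {f})) = card (insert h (par e)) + card (X - {f})"
    using h_F XF by (intro card_Un_disjoint) (auto simp: X_def)
  moreover have "h \<notin> par e" using h_F par_sub[of u e] e by (auto simp: F_def)
  then have "card (insert h (par e)) = 4" using par3 by simp
  moreover have "card (X - {f}) + 1 = card X"
    using f_X by (metis Suc_eq_plus1 X_def card_Suc_Diff1 fin(1) finite_Diff)
  ultimately have "card X + 3 \<le> card {t \<in> insert h F. adj f t}" by linarith
  moreover have "insert h F \<subseteq> S" using FS hS by blast
  ultimately show False
    using card_residual[of "insert h F" f c0] f(1) nb_le[OF f(1)] card_Rf by fastforce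
qed

end

section \<open>Maximum cuts\<close>

context critical_edges
begin

lemma ends_eq:
  assumes "e \<in> S" "u \<in> en e" "v \<in> en e" "u \<noteq> v"
  shows "en e = {u, v}"
  using ends_cases[OF assms(1,2)] assms(3,4) by (metis empty_iff insert_iff)

lemma card_par_le: "e \<in> S \<Longrightarrow> card (par e) \<le> 3"
proof -
  assume e: "e \<in> S"
  then have "en e \<noteq> {}" using card_en S_sub by fastforce
  then obtain u v where "en e = {u, v}" "u \<noteq> v" using ends_cases[OF e] by blast
  from triple(1)[OF e this] show ?thesis by (cases "3 \<le> card (par e)") auto
qed

lemma par_eq: "f \<in> par e \<Longrightarrow> par f = par e" by (auto simp: par_def)

lemma par_disjoint: "e \<in> S \<Longrightarrow> f \<in> S \<Longrightarrow> f \<notin> par e \<Longrightarrow> par e \<inter> par f = {}"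
  by (auto simp: par_def)

definition crosses :: "'v set \<Rightarrow> 'e \<Rightarrow> bool" where
  "crosses W e \<longleftrightarrow> (\<exists>x \<in> en e. x \<in> W) \<and> (\<exists>y \<in> en e. y \<notin> W)"

lemma crosses_ends: "en e = {u, v} \<Longrightarrow> crosses W e \<longleftrightarrow> (u \<in> W) \<noteq> (v \<in> W)"
  by (auto simp: crosses_def)

lemma max_cut_exists: "\<exists>U. \<forall>W. card {e \<in> S. crosses W e} \<le> card {e \<in> S. crosses U e}"
proof -
  have "card {e \<in> S. crosses W e} < Suc (card S)" for W
    using card_mono[OF finS, of "{e \<in> S. crosses W e}"] by (simp add: less_Suc_eq_le)
  then show ?thesis
    using ex_has_greatest_nat[of "\<lambda>_. True" "{}" "\<lambda>W. card {e \<in> S. crosses W e}" "Suc (card S)"]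
    by auto
qed

end

locale max_cut = critical_edges +
  fixes U :: "'b set"
  assumes max_cut: "card {e \<in> S. crosses W e} \<le> card {e \<in> S. crosses U e}"
begin

definition Bs :: "'a set" where "Bs = {e \<in> S. crosses U e}"

definition Rs :: "'a set" where "Rs = {e \<in> S. \<not> crosses U e}"

definition dB :: "'b \<Rightarrow> nat" where "dB v = card {e \<in> Bs. v \<in> en e}"

definition dR :: "'b \<Rightarrow> nat" where "dR v = card {e \<in> Rs. v \<in> en e}"

lemma Bs_sub: "Bs \<subseteq> S" by (auto simp: Bs_def)

lemma fin_BR: "finite Bs" "finite Rs" using finS by (simp_all add: Bs_def Rs_def)

text \<open>Moving all vertices of \<open>W\<close> to the other side exchanges the cut status of
  exactly the edges that cross \<open>W\<close>.\<close>

lemma flip: "card {e \<in> Rs. crosses W e} \<le> card {e \<in> Bs. crosses W e}"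
proof -
  define U' where "U' = (U - W) \<union> (W - U)"
  have "crosses U' e \<longleftrightarrow> crosses U e \<noteq> crosses W e" if e: "e \<in> S" for e
  proof -
    have "en e \<noteq> {}" using card_en e S_sub by fastforce
    then obtain u v where "en e = {u, v}" using ends_cases[OF e] by blast
    then show ?thesis by (auto simp: crosses_ends U'_def)
  qed
  then have "{e \<in> S. crosses U' e} = {e \<in> Bs. \<not> crosses W e} \<union> {e \<in> Rs. crosses W e}"
    by (auto simp: Bs_def Rs_def)
  moreover have "card ({e \<in> Bs. \<not> crosses W e} \<union> {e \<in> Rs. crosses W e})
      = card {e \<in> Bs. \<not> crosses W e} + card {e \<in> Rs. crosses W e}"
    using finS by (intro card_Un_disjoint) (auto simp: Bs_def Rs_def)
  ultimately have "card {e \<in> S. crosses U' e} = card {e \<in> Bs. \<not> crosses W e} + card {e \<in> Rs. crosses W e}"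
    by simp
  moreover have "card Bs = card {e \<in> Bs. \<not> crosses W e} + card {e \<in> Bs. crosses W e}"
  proof -
    have "Bs = {e \<in> Bs. \<not> crosses W e} \<union> {e \<in> Bs. crosses W e}" by auto
    then show ?thesis
      using fin_BR card_Un_disjoint[of "{e \<in> Bs. \<not> crosses W e}" "{e \<in> Bs. crosses W e}"] by fastforce
  qed
  moreover have "card {e \<in> S. crosses U' e} \<le> card Bs" using max_cut unfolding Bs_def .
  ultimately show ?thesis by linarith
qed

lemma deg_split: "deg v = dB v + dR v"
proof -
  have "star v = {e \<in> Bs. v \<in> en e} \<union> {e \<in> Rs. v \<in> en e}" by (auto simp: star_def Bs_def Rs_def)
  moreover have "{e \<in> Bs. v \<in> en e} \<inter> {e \<in> Rs. v \<in> en e} = {}" by (auto simp: Bs_def Rs_def)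
  ultimately show ?thesis
    using fin_BR by (simp add: deg_def dB_def dR_def card_Un_disjoint)
qed

lemma dR_le_dB: "dR v \<le> dB v"
proof -
  have "crosses {v} e \<longleftrightarrow> v \<in> en e" if e: "e \<in> S" for e
  proof -
    have "en e \<noteq> {}" using card_en e S_sub by fastforce
    then obtain a b where "en e = {a, b}" "a \<noteq> b" using ends_cases[OF e] by blast
    then show ?thesis by (auto simp: crosses_ends)
  qed
  then have "{e \<in> Rs. crosses {v} e} = {e \<in> Rs. v \<in> en e}" "{e \<in> Bs. crosses {v} e} = {e \<in> Bs. v \<in> en e}"
    by (auto simp: Bs_def Rs_def)
  then show ?thesis using flip[of "{v}"] by (simp add: dB_def dR_def)
qed

lemma par_Bs: "e \<in> Bs \<Longrightarrow> par e \<subseteq> Bs" by (auto simp: Bs_def par_def crosses_def)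

text \<open>When both ends move, the class of \<open>e\<close> stays in the cut while all other
  edges at \<open>u\<close> and \<open>v\<close> are switched. This beats the two single moves
  together by \<open>2 * card (par e)\<close>.\<close>

lemma flip_pair:
  assumes e: "e \<in> Bs" "en e = {u, v}" "u \<noteq> v"
  shows "dR u + dR v + 2 * card (par e) \<le> dB u + dB v"
proof -
  have cross: "crosses {u, v} f \<longleftrightarrow> (u \<in> en f) \<noteq> (v \<in> en f)" if f: "f \<in> S" for f
  proof -
    have "en f \<noteq> {}" using card_en f S_sub by fastforce
    then obtain a b where "en f = {a, b}" "a \<noteq> b" using ends_cases[OF f] by blast
    then show ?thesis using e(3) by (auto simp: crosses_ends)
  qed
  have both: "f \<in> par e" if "f \<in> S" "u \<in> en f" "v \<in> en f" for f
    using ends_eq[OF that e(3)] e(2) that(1) by (simp add: par_def)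
  have par_uv: "u \<in> en f" "v \<in> en f" if "f \<in> par e" for f using that e(2) by (auto simp: par_def)
  have no_R: "f \<notin> Rs" if "f \<in> par e" for f using par_Bs[OF e(1)] that by (auto simp: Bs_def Rs_def)
  have "{f \<in> Rs. crosses {u, v} f} = {f \<in> Rs. u \<in> en f} \<union> {f \<in> Rs. v \<in> en f}"
    using cross both no_R by (auto simp: Rs_def)
  moreover have "{f \<in> Rs. u \<in> en f} \<inter> {f \<in> Rs. v \<in> en f} = {}"
    using both no_R by (auto simp: Rs_def)
  ultimately have R: "card {f \<in> Rs. crosses {u, v} f} = dR u + dR v"
    using fin_BR by (simp add: dR_def card_Un_disjoint)
  let ?Bu = "{f \<in> Bs. u \<in> en f}" and ?Bv = "{f \<in> Bs. v \<in> en f}"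
  have "{f \<in> Bs. crosses {u, v} f} = (?Bu - par e) \<union> (?Bv - par e)"
    using cross both par_uv by (auto simp: Bs_def)
  moreover have "(?Bu - par e) \<inter> (?Bv - par e) = {}" using both by (auto simp: Bs_def)
  ultimately have "card {f \<in> Bs. crosses {u, v} f} = card (?Bu - par e) + card (?Bv - par e)"
    using fin_BR by (simp add: card_Un_disjoint)
  moreover have "par e \<subseteq> ?Bu" "par e \<subseteq> ?Bv" using par_Bs[OF e(1)] par_uv by auto
  then have "card (?Bu - par e) + card (par e) = dB u" "card (?Bv - par e) + card (par e) = dB v"
    using fin_BR by (simp_all add: dB_def card_Diff_subset card_mono)
  ultimately show ?thesis using flip[of "{u, v}"] R by linarith
qed

lemma two_classes_le_dB:
  assumes "e \<in> Bs" "f \<in> Bs" "v \<in> en e" "v \<in> en f" "f \<notin> par e"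
  shows "card (par e) + card (par f) \<le> dB v"
proof -
  have "par e \<inter> par f = {}" using par_disjoint assms Bs_sub by blast
  then have "card (par e) + card (par f) = card (par e \<union> par f)" by (simp add: card_Un_disjoint)
  also have "\<dots> \<le> dB v"
    unfolding dB_def using par_Bs assms fin_BR by (intro card_mono) (auto simp: par_def)
  finally show ?thesis .
qed

lemma slack_par:
  assumes "e \<in> S" "f \<in> par e"
  shows "slack f = slack e"
proof -
  have "en e \<noteq> {}" using card_en assms(1) S_sub by fastforce
  then obtain u v where uv: "en e = {u, v}" "u \<noteq> v" using ends_cases[OF assms(1)] by blast
  have f: "f \<in> S" "en f = {u, v}" using assms(2) uv by (simp_all add: par_def)
  show ?thesis using degree_sum[OF assms(1) uv] degree_sum[OF f uv(2)] par_eq[OF assms(2)] by simp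
qed

text \<open>
  Galvin's method requires that every cut edge \<open>e\<close> is preferred to at least \<open>card (par e) + 1 - slack e\<close>
  others at its two ends; \<open>bipartite_preferences\<close> guarantees one less for triple edges at a bad vertex.
\<close>

definition bad :: "'b \<Rightarrow> bool" where
  "bad v \<longleftrightarrow> (\<exists>e \<in> Bs. v \<in> en e \<and> card (par e) = 3 \<and> dB v + slack e \<le> 4)"

text \<open>A bad \<open>v\<close> has only \<open>4 - slack e\<close> cut edges, hence at least
  three uncut ones, and \<open>flip_pair\<close> turns this into an excess of cut edges over uncut
  ones at \<open>u\<close>. The bound 7 fails only if \<open>u\<close> has degree exactly 6 in
  \<open>S\<close>.\<close>

lemma partner:
  assumes e: "e \<in> Bs" "en e = {u, v}" "u \<noteq> v" and par: "card (par e) = 3"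
    and small: "dB v + slack e \<le> 4"
  shows "dB v + slack e = 4" and "7 \<le> dB u \<or> 6 \<le> dB u \<and> deg u = 6 \<and> slack e = 1 \<and> deg v = 6"
proof -
  have eS: "e \<in> S" using e(1) Bs_sub by blast
  have sum: "deg u + deg v + slack e = k + 5" using degree_sum[OF eS e(2,3)] par by simp
  have ge: "7 \<le> deg v + slack e" "7 \<le> deg u + slack e" using degree_ge[OF eS] e(2) by simp_all
  have s: "slack e \<le> 1" using slack(2)[OF eS] .
  note split = deg_split[of u] deg_split[of v] and cut = dR_le_dB[of v] dR_le_dB[of u]
  have fp: "dR u + dR v + 6 \<le> dB u + dB v" using flip_pair[OF e] par by simp
  show dBv: "dB v + slack e = 4" using ge s split cut small by linarith
  show "7 \<le> dB u \<or> 6 \<le> dB u \<and> deg u = 6 \<and> slack e = 1 \<and> deg v = 6"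
  proof (cases "slack e = 0")
    case True
    \<comment> \<open>Of four cut edges at \<open>v\<close>, one lies outside \<open>par e\<close>
      and is alone in its class. Comparing the degree sums along \<open>e\<close> and along this
      edge gives \<open>deg u \<ge> 9\<close>.\<close>
    have "par e \<noteq> {f \<in> Bs. v \<in> en f}" using par dBv True by (auto simp: dB_def)
    moreover have "par e \<subseteq> {f \<in> Bs. v \<in> en f}" using par_Bs[OF e(1)] e(2) by (auto simp: par_def)
    ultimately obtain f where f: "f \<in> Bs" "v \<in> en f" "f \<notin> par e" by blast
    have fS: "f \<in> S" using f(1) Bs_sub by blast
    obtain w where w: "en f = {v, w}" "v \<noteq> w" using ends_cases[OF fS f(2)] .
    have "card (par e) + card (par f) \<le> dB v" using two_classes_le_dB[OF e(1) f(1) _ f(2,3)] e(2) by simp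
    then have "card (par f) \<le> 1" using par dBv True by simp
    then have "deg v + deg w + slack f \<le> k + 3" using degree_sum[OF fS w] by simp
    moreover have "7 \<le> deg w + slack f" using degree_ge[OF fS] w by simp
    ultimately show ?thesis using sum True dBv ge split fp by linarith
  next
    case False
    then have "slack e = 1" using s by simp
    then show ?thesis using dBv ge split fp cut by linarith
  qed
qed

text \<open>Two triples at \<open>u\<close> fill its star by \<open>two_triples\<close>, so
  \<open>u\<close> has degree 6 and is the exceptional case of \<open>partner\<close>. Then
  \<open>u\<close>, \<open>v\<close> and \<open>y\<close> all have degree 6 in \<open>S\<close> and
  each lacks an edge of \<open>E\<close>. As \<open>e\<close> and \<open>f\<close> have only one
  missing neighbour each, it is the same edge at all three vertices, which is too many ends.\<close>

lemma partner_unique_triple: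
  assumes e: "e \<in> Bs" "en e = {u, v}" "u \<noteq> v" and par: "card (par e) = 3"
    and small: "dB v + slack e \<le> 4" and f: "f \<in> star u" "card (par f) = 3"
  shows "f \<in> par e"
proof (rule ccontr)
  assume fe: "f \<notin> par e"
  have eS: "e \<in> S" using e(1) Bs_sub by blast
  have fS: "f \<in> S" "u \<in> en f" using f(1) by (simp_all add: star_def)
  obtain y where y: "en f = {u, y}" "u \<noteq> y" using ends_cases[OF fS] .
  have vy: "v \<noteq> y" using fe y fS e(2) by (auto simp: par_def)
  have "star u \<subseteq> par e \<union> par f"
  proof (rule ccontr)
    assume "\<not> ?thesis"
    then obtain g where "g \<in> star u" "g \<notin> par e" "g \<notin> par f" by blast
    then show False using two_triples[OF eS e(2,3) _ fS(1) y _ vy] par f(2) by simp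
  qed
  then have "deg u \<le> card (par e \<union> par f)" unfolding deg_def by (intro card_mono) auto
  also have "\<dots> \<le> 6" using card_Un_le[of "par e" "par f"] par f(2) by simp
  finally have "deg u \<le> 6" .
  then have *: "deg u = 6" "slack e = 1" "deg v = 6"
    using partner(2)[OF e par small] deg_split[of u] by auto
  have k: "k = 8" using degree_sum[OF eS e(2,3)] par * by simp
  have sf: "slack f = 1" using degree_ge[OF fS] * slack(2)[OF fS(1)] by simp
  have dy: "deg y = 6" using degree_sum[OF fS(1) y] f(2) * k sf by simp
  have unique: "m1 = m2" if e': "e' \<in> S" "slack e' = 1" "m1 \<in> E - S" "m2 \<in> E - S"
    "en m1 \<inter> en e' \<noteq> {}" "en m2 \<inter> en e' \<noteq> {}" for e' m1 m2
  proof -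
    let ?M = "{f \<in> E - S. adj e' f}"
    have "card ?M \<le> Suc 0" using missing_edges[OF e'(1)] e'(2) by simp
    moreover have "finite ?M" using finE by simp
    moreover have "m1 \<in> ?M" "m2 \<in> ?M" using e' by (auto simp: adjacent_def)
    ultimately show ?thesis using card_le_Suc0_iff_eq by blast
  qed
  have ex: "\<exists>m \<in> E - S. w \<in> en m" if "g \<in> S" "w \<in> en g" "deg w = 6" for g w
  proof -
    have "card {m \<in> E - S. w \<in> en m} \<noteq> 0" using degree_E[OF that(1,2)] that(3) by simp
    then show ?thesis by (metis (mono_tags, lifting) card.empty empty_Collect_eq)
  qed
  obtain m1 where m1: "m1 \<in> E - S" "u \<in> en m1" using ex[OF eS, of u] e(2) * by auto
  obtain m2 where m2: "m2 \<in> E - S" "v \<in> en m2" using ex[OF eS, of v] e(2) * by auto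
  obtain m3 where m3: "m3 \<in> E - S" "y \<in> en m3" using ex[OF fS(1), of y] y dy by auto
  have "m1 = m2" using unique[OF eS *(2) m1(1) m2(1)] m1 m2 e(2) by auto
  moreover have "m1 = m3" using unique[OF fS(1) sf m1(1) m3(1)] m1 m3 y by auto
  ultimately have "{u, v, y} \<subseteq> en m1" using m1 m2 m3 by auto
  moreover have "card (en m1) = 2" using card_en m1(1) by blast
  moreover have "finite (en m1)" using \<open>card (en m1) = 2\<close> card.infinite by fastforce
  ultimately have "card {u, v, y} \<le> 2" by (metis card_mono)
  then show False using e(3) y(2) vy by simp
qed

text \<open>Two triple classes at one vertex need six cut edges, but a bad vertex has at most four,
  so its witnessing class is the only one.\<close>

lemma bad_triple:
  assumes "bad v" "f \<in> Bs" "v \<in> en f" "card (par f) = 3"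
  shows "dB v + slack f \<le> 4"
proof -
  obtain e where e: "e \<in> Bs" "v \<in> en e" "card (par e) = 3" "dB v + slack e \<le> 4"
    using assms(1) by (auto simp: bad_def)
  have "f \<in> par e"
  proof (rule ccontr)
    assume "f \<notin> par e"
    then show False using two_classes_le_dB[OF e(1) assms(2) e(2) assms(3)] assms(4) e(3,4) by simp
  qed
  then show ?thesis using slack_par[of e f] e Bs_sub by (metis subset_iff)
qed

lemma bad_dB: "bad v \<Longrightarrow> dB v \<le> 4"
  by (auto simp: bad_def)

lemma bad_obtain:
  assumes "bad v"
  obtains e where "e \<in> Bs" "v \<in> en e" "card (par e) = 3"
  using assms by (auto simp: bad_def)

text \<open>The second claim is the one for the orders: with \<open>par f\<close> on top at
  \<open>u\<close>, the remaining \<open>dB u - 3\<close> cut edges are below it, and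
  \<open>4 = card (par f) + 1\<close> is the demand.\<close>

lemma bad_neighbour:
  assumes f: "f \<in> Bs" "en f = {u, v}" "u \<noteq> v" "card (par f) = 3" "bad v"
  shows "\<not> bad u" "4 \<le> dB u - 3 + slack f" "g \<in> star u \<Longrightarrow> card (par g) = 3 \<Longrightarrow> g \<in> par f"
    and "7 \<le> dB u \<or> 6 \<le> dB u \<and> deg u = 6"
proof -
  have small: "dB v + slack f \<le> 4" using bad_triple[OF f(5,1) _ f(4)] f(2) by simp
  note p = partner(2)[OF f(1-4) small]
  then show "\<not> bad u" using bad_dB[of u] by auto
  show "4 \<le> dB u - 3 + slack f" "7 \<le> dB u \<or> 6 \<le> dB u \<and> deg u = 6" using p by auto
  show "g \<in> star u \<Longrightarrow> card (par g) = 3 \<Longrightarrow> g \<in> par f"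
    using partner_unique_triple[OF f(1-4) small] .
qed

text \<open>These edges go above all others at a vertex \<open>x\<close> that is not bad, so the
  other edges at \<open>x\<close> cannot count them as worse.\<close>

definition bad_triples :: "'b \<Rightarrow> 'a set" where
  "bad_triples x = {f \<in> Bs. x \<in> en f \<and> card (par f) = 3 \<and> (\<exists>y \<in> en f. y \<noteq> x \<and> bad y)}"

text \<open>Without bad triples at \<open>x\<close> this is half of the degree 7, or the failure of
  badness if \<open>par e\<close> is a triple. Otherwise the bad triples are one class of three and
  the only triple at \<open>x\<close>, so \<open>card (par e) \<le> 2\<close>, and the 7 needed is
  supplied by \<open>bad_neighbour\<close>. The summand 2 covers the demand plus one and the loss of
  one in \<open>bipartite_preferences\<close>.\<close>

lemma good_end:
  assumes e: "e \<in> Bs" "x \<in> en e" "\<And>y. y \<in> en e \<Longrightarrow> \<not> bad y"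
  shows "card (par e) + 2 + card (bad_triples x) \<le> dB x + slack e"
proof -
  have eS: "e \<in> S" using e(1) Bs_sub by blast
  have ge: "7 \<le> deg x + slack e" using degree_ge[OF eS e(2)] .
  have s: "slack e \<le> 1" using slack(2)[OF eS] .
  have le3: "card (par e) \<le> 3" using card_par_le[OF eS] .
  show ?thesis
  proof (cases "bad_triples x = {}")
    case True
    have "5 \<le> dB x + slack e" if "card (par e) = 3"
      using e that by (auto simp: bad_def not_less_eq_eq)
    moreover have "card (par e) + 2 \<le> dB x + slack e" if "card (par e) \<le> 2"
      using that ge s deg_split[of x] dR_le_dB[of x] by linarith
    ultimately show ?thesis using True le3 by (cases "card (par e) = 3") auto
  next
    case False
    then obtain f y where f: "f \<in> Bs" "x \<in> en f" "card (par f) = 3" "y \<in> en f" "x \<noteq> y" "bad y"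
      by (auto simp: bad_triples_def)
    have fS: "f \<in> S" using f(1) Bs_sub by blast
    have enf: "en f = {x, y}" using ends_eq[OF fS f(2,4,5)] .
    note nb = bad_neighbour[OF f(1) enf f(5,3,6)]
    have "bad_triples x \<subseteq> par f" using nb(3) Bs_sub by (auto simp: bad_triples_def star_def)
    then have "card (bad_triples x) \<le> 3" using f(3) card_mono[of "par f"] by fastforce
    moreover have "e \<notin> par f" using e(3) f(4,6) by (auto simp: par_def)
    then have "card (par e) \<noteq> 3" using nb(3)[of e] e(2) eS by (auto simp: star_def)
    ultimately show ?thesis using nb(4) le3 ge s by linarith
  qed
qed

end

section \<open>Preference orders on the cut edges\<close>

context max_cut
begin

definition top_end :: "'a \<Rightarrow> 'b" where "top_end e = (THE x. x \<in> en e \<and> x \<in> U)"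

definition bot_end :: "'a \<Rightarrow> 'b" where "bot_end e = (THE x. x \<in> en e \<and> x \<notin> U)"

lemma ends_Bs:
  assumes "e \<in> Bs"
  shows "en e = {top_end e, bot_end e}" "top_end e \<in> U" "bot_end e \<notin> U" "top_end e \<noteq> bot_end e"
proof -
  obtain x y where xy: "x \<in> en e" "x \<in> U" "y \<in> en e" "y \<notin> U"
    using assms by (auto simp: Bs_def crosses_def)
  then have en: "en e = {x, y}" using assms Bs_sub by (intro ends_eq) auto
  have "top_end e = x" "bot_end e = y"
    using xy unfolding top_end_def bot_end_def en by (auto intro!: the_equality)
  then show "en e = {top_end e, bot_end e}" "top_end e \<in> U" "bot_end e \<notin> U" "top_end e \<noteq> bot_end e"
    using en xy by auto
qed

lemma in_ends_Bs:
  assumes "e \<in> Bs"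
  shows "x \<in> U \<Longrightarrow> x \<in> en e \<longleftrightarrow> top_end e = x" "x \<notin> U \<Longrightarrow> x \<in> en e \<longleftrightarrow> bot_end e = x"
  using ends_Bs[OF assms] by auto

definition good :: "'a set" where "good = {f \<in> Bs. \<forall>y \<in> en f. \<not> bad y}"

text \<open>
  The edges of \<open>good\<close> are ordered by \<open>bipartite_preferences\<close>. Edges placed below them make up for the
  loss of degree, and the triple edges placed above them are affordable by \<open>good_end\<close>.
\<close>

definition level :: "'b \<Rightarrow> 'a \<Rightarrow> nat" where
  "level x f = (if bad x then (if card (par f) = 3 then 1 else 0)
    else if \<exists>y \<in> en f. bad y then (if card (par f) = 3 then 0 else 2) else 1)"

lemma good_sub: "good \<subseteq> Bs" by (auto simp: good_def)

lemma level_good: "f \<in> Bs \<Longrightarrow> x \<in> en f \<Longrightarrow> \<not> bad x \<Longrightarrow> level x f = 1 \<longleftrightarrow> f \<in> good"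
  by (auto simp: level_def good_def)

lemma dB_levels:
  assumes "\<not> bad x"
  shows "dB x = card {g \<in> good. x \<in> en g} + card {g \<in> Bs. x \<in> en g \<and> level x g = 2} + card (bad_triples x)"
proof -
  have "{g \<in> Bs. x \<in> en g} = ({g \<in> good. x \<in> en g} \<union> {g \<in> Bs. x \<in> en g \<and> level x g = 2}) \<union> bad_triples x"
    using assms by (auto simp: good_def level_def bad_triples_def)
  moreover have "card (({g \<in> good. x \<in> en g} \<union> {g \<in> Bs. x \<in> en g \<and> level x g = 2}) \<union> bad_triples x)
      = card ({g \<in> good. x \<in> en g} \<union> {g \<in> Bs. x \<in> en g \<and> level x g = 2}) + card (bad_triples x)"
    using assms fin_BR good_sub
    by (intro card_Un_disjoint) (auto simp: good_def level_def bad_triples_def)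
  moreover have "card ({g \<in> good. x \<in> en g} \<union> {g \<in> Bs. x \<in> en g \<and> level x g = 2})
      = card {g \<in> good. x \<in> en g} + card {g \<in> Bs. x \<in> en g \<and> level x g = 2}"
    using assms fin_BR by (intro card_Un_disjoint) (auto simp: good_def level_def)
  ultimately show ?thesis by (simp add: dB_def)
qed

definition lower :: "('b \<Rightarrow> 'a \<Rightarrow> nat \<times> nat) \<Rightarrow> 'b \<Rightarrow> 'a \<Rightarrow> 'a set" where
  "lower key x f = {g \<in> Bs. x \<in> en g \<and> key x f < key x g}"

lemma fin_lower: "finite (lower key x f)" using fin_BR by (simp add: lower_def)

text \<open>One end is enough. A single or double edge at a bad \<open>v\<close> stands above the
  triple there and, since \<open>dB v \<le> 4\<close>, is alone in its class. A triple edge with a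
  bad end stands at its other end above everything outside its class, which suffices by
  \<open>bad_neighbour\<close>.\<close>

lemma lower_bad_edge:
  assumes key: "\<And>x f g. level x f < level x g \<Longrightarrow> key x f < key x g"
    and f: "f \<in> Bs" "v \<in> en f" "bad v"
  shows "\<exists>x \<in> en f. card (par f) + 1 \<le> card (lower key x f) + slack f"
proof (cases "card (par f) = 3")
  case False
  obtain e where e: "e \<in> Bs" "v \<in> en e" "card (par e) = 3" using bad_obtain[OF f(3)] .
  have "g \<in> lower key v f" if "g \<in> par e" for g
  proof -
    have "card (par g) = 3" using par_eq[OF that] e(3) by simp
    then have "level v f < level v g" using f(3) False by (simp add: level_def)
    then show ?thesis using key that par_Bs[OF e(1)] e(2) by (auto simp: lower_def par_def)
  qed
  then have "3 \<le> card (lower key v f)" using e(3) card_mono[OF fin_lower, of "par e" key v f] by auto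
  moreover have "f \<notin> par e" using par_eq[of f e] e(3) False by auto
  then have "card (par e) + card (par f) \<le> 4"
    using two_classes_le_dB[OF e(1) f(1) e(2) f(2)] bad_dB[OF f(3)] by simp
  ultimately show ?thesis using f(2) e(3) by (intro bexI[of _ v]) auto
next
  case True
  have fS: "f \<in> S" using f(1) Bs_sub by blast
  obtain u where u: "en f = {v, u}" "v \<noteq> u" using ends_cases[OF fS f(2)] .
  then have enf: "en f = {u, v}" "u \<noteq> v" by auto
  note nb = bad_neighbour[OF f(1) enf True f(3)]
  have lev: "level u f = 0" using nb(1) u f(3) True by (auto simp: level_def)
  have "g \<in> lower key u f" if g: "g \<in> Bs" "u \<in> en g" "g \<notin> par f" for g
  proof -
    have "card (par g) \<noteq> 3" using nb(3)[of g] g Bs_sub by (auto simp: star_def)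
    then have "level u f < level u g" using nb(1) lev by (simp add: level_def)
    then show ?thesis using key g by (simp add: lower_def)
  qed
  then have "{g \<in> Bs. u \<in> en g} - par f \<subseteq> lower key u f" by blast
  then have "card ({g \<in> Bs. u \<in> en g} - par f) \<le> card (lower key u f)" by (rule card_mono[OF fin_lower])
  moreover have "dB u - card (par f) \<le> card ({g \<in> Bs. u \<in> en g} - par f)"
    unfolding dB_def by (rule diff_card_le_card_Diff) simp
  ultimately show ?thesis using nb(2) True u by (intro bexI[of _ u]) auto
qed

lemma preferences:
  "\<exists>key. (\<forall>x. inj_on (key x) {f \<in> Bs. x \<in> en f}) \<and> (\<forall>f \<in> Bs. card (par f) + 1
      \<le> card (lower key (top_end f) f) + card (lower key (bot_end f) f) + slack f)"
proof -
  have fin_good: "finite good" using good_sub fin_BR finite_subset by blast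
  obtain u w :: "'a \<Rightarrow> nat" where uw: "pref_distinct top_end u good" "pref_distinct bot_end w good"
    "\<forall>e \<in> good. min (card (fibre top_end good (top_end e))) (card (fibre bot_end good (bot_end e)))
      \<le> card (worse top_end u good e) + card (worse bot_end w good e) + 1"
    using bipartite_preferences[OF fin_good] by blast
  obtain idx :: "'a \<Rightarrow> nat" where idx: "inj_on idx Bs"
    using finite_imp_inj_to_nat_seg[OF fin_BR(1)] by blast
  define uw' where "uw' x f = (if x \<in> U then u f else w f)" for x f
  \<comment> \<open>Levels decide first. The two kinds of tie-breakers never meet on one level: a
    bad vertex has no good edges, and elsewhere level 1 consists exactly of the good ones.\<close>
  define key where "key x f = (level x f, if f \<in> good then uw' x f else idx f)" for x f
  have inj: "inj_on (key x) {f \<in> Bs. x \<in> en f}" for x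
  proof (rule inj_onI)
    fix f g assume f: "f \<in> {f \<in> Bs. x \<in> en f}" and g: "g \<in> {f \<in> Bs. x \<in> en f}" and eq: "key x f = key x g"
    then have lev: "level x f = level x g" by (simp add: key_def)
    have iff: "f \<in> good \<longleftrightarrow> g \<in> good"
    proof (cases "bad x")
      case True
      then show ?thesis using f g by (auto simp: good_def)
    next
      case False
      then show ?thesis using level_good[of f x] level_good[of g x] f g lev by simp
    qed
    show "f = g"
    proof (cases "f \<in> good")
      case True
      then have eq': "uw' x f = uw' x g" and g': "g \<in> good" using eq iff by (simp_all add: key_def)
      show ?thesis
      proof (cases "x \<in> U")
        case U: True
        then have "u f = u g" "top_end f = top_end g"
          using eq' in_ends_Bs(1)[of f x] in_ends_Bs(1)[of g x] f g by (simp_all add: uw'_def)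
        then show ?thesis using uw(1) True g' unfolding pref_distinct_def by blast
      next
        case U: False
        then have "w f = w g" "bot_end f = bot_end g"
          using eq' in_ends_Bs(2)[of f x] in_ends_Bs(2)[of g x] f g by (simp_all add: uw'_def)
        then show ?thesis using uw(2) True g' unfolding pref_distinct_def by blast
      qed
    next
      case False
      then show ?thesis using eq iff idx f g by (simp add: key_def inj_on_def)
    qed
  qed
  have le: "level x f < level x g \<Longrightarrow> key x f < key x g" for x f g by (simp add: key_def)
  have main: "card (par f) + 1 \<le> card (lower key (top_end f) f) + card (lower key (bot_end f) f) + slack f"
    if f: "f \<in> Bs" for f
  proof (cases "f \<in> good")
    case False
    then obtain v where "v \<in> en f" "bad v" using f by (auto simp: good_def)
    from lower_bad_edge[of key, OF le f this] show ?thesis using ends_Bs(1)[OF f] by auto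
  next
    case True
    have nbad: "\<not> bad x" if "x \<in> en f" for x using True that by (simp add: good_def)
    define W where "W x = {g \<in> good. x \<in> en g \<and> uw' x f < uw' x g}" for x
    define T where "T x = {g \<in> Bs. x \<in> en g \<and> level x g = 2}" for x
    have fin: "finite (W x)" "finite (T x)" for x using fin_good fin_BR by (simp_all add: W_def T_def)
    have low: "card (W x) + card (T x) \<le> card (lower key x f)" if x: "x \<in> en f" for x
    proof -
      have levf: "level x f = 1" using level_good[OF f x nbad[OF x]] True by simp
      have lev1: "level x g = 1" if "g \<in> good" "x \<in> en g" for g
        using level_good[of g x] nbad[OF x] that good_sub by blast
      then have "W x \<inter> T x = {}" by (auto simp: W_def T_def)
      then have "card (W x) + card (T x) = card (W x \<union> T x)" using fin by (simp add: card_Un_disjoint)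
      also have "\<dots> \<le> card (lower key x f)"
      proof (rule card_mono[OF fin_lower], rule subsetI)
        fix g assume "g \<in> W x \<union> T x"
        then consider "g \<in> W x" | "g \<in> T x" by blast
        then show "g \<in> lower key x f"
        proof cases
          case 1
          then have "g \<in> good" "x \<in> en g" "g \<in> Bs" using good_sub by (auto simp: W_def)
          moreover then have "level x g = 1" using lev1 by blast
          ultimately show ?thesis using 1 True levf by (simp add: W_def lower_def key_def)
        next
          case 2
          then show ?thesis using levf by (simp add: T_def lower_def key_def)
        qed
      qed
      finally show ?thesis .
    qed
    have t: "top_end f \<in> en f" and b: "bot_end f \<in> en f" using ends_Bs[OF f] by auto
    have Wt: "W (top_end f) = worse top_end u good f"
      using in_ends_Bs(1) ends_Bs(2)[OF f] good_sub by (auto simp: W_def worse_def uw'_def)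
    have Wb: "W (bot_end f) = worse bot_end w good f"
      using in_ends_Bs(2) ends_Bs(3)[OF f] good_sub by (auto simp: W_def worse_def uw'_def)
    have Ft: "{g \<in> good. top_end f \<in> en g} = fibre top_end good (top_end f)"
      using in_ends_Bs(1) ends_Bs(2)[OF f] good_sub by (auto simp: fibre_def)
    have Fb: "{g \<in> good. bot_end f \<in> en g} = fibre bot_end good (bot_end f)"
      using in_ends_Bs(2) ends_Bs(3)[OF f] good_sub by (auto simp: fibre_def)
    \<comment> \<open>At either end, the degree in \<open>good\<close> plus the edges of level 2
      reaches the demand plus one. The level 2 edges lie below \<open>f\<close>, so they repay what
      the minimum over \<open>good\<close> lacks.\<close>
    have "min (card (fibre top_end good (top_end f))) (card (fibre bot_end good (bot_end f)))
        \<le> card (W (top_end f)) + card (W (bot_end f)) + 1"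
      using uw(3) True unfolding Wt Wb by blast
    moreover have "card (par f) + 2 \<le> card (fibre top_end good (top_end f)) + card (T (top_end f)) + slack f"
      using good_end[OF f t nbad] dB_levels[OF nbad[OF t]] unfolding Ft T_def by linarith
    moreover have "card (par f) + 2 \<le> card (fibre bot_end good (bot_end f)) + card (T (bot_end f)) + slack f"
      using good_end[OF f b nbad] dB_levels[OF nbad[OF b]] unfolding Fb T_def by linarith
    ultimately show ?thesis using low[OF t] low[OF b] by linarith
  qed
  show ?thesis by (intro exI[of _ key] conjI allI ballI inj main)
qed

lemma rank_lower:
  assumes inj: "inj_on (key x) {f \<in> Bs. x \<in> en f}" and f: "f \<in> Bs" "x \<in> en f"
  shows "card {g \<in> Bs. x \<in> en g \<and> key x g < key x f} + card (lower key x f) + 1 = dB x"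
proof -
  let ?A = "{g \<in> Bs. x \<in> en g \<and> key x g < key x f}"
  have "{g \<in> Bs. x \<in> en g} = insert f (?A \<union> lower key x f)"
  proof (intro equalityI subsetI)
    fix g assume g: "g \<in> {g \<in> Bs. x \<in> en g}"
    then have "g = f \<or> key x g \<noteq> key x f" using inj f by (auto dest: inj_onD)
    then show "g \<in> insert f (?A \<union> lower key x f)" using g by (auto simp: lower_def)
  qed (use f in \<open>auto simp: lower_def\<close>)
  moreover have "f \<notin> ?A \<union> lower key x f" by (simp add: lower_def)
  moreover have "card (?A \<union> lower key x f) = card ?A + card (lower key x f)"
    using fin_BR fin_lower by (intro card_Un_disjoint) (auto simp: lower_def)
  ultimately show ?thesis using fin_BR fin_lower by (simp add: dB_def)
qed

lemma card_adjacent_Bs: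
  assumes f: "f \<in> Bs"
  shows "card {g \<in> Bs. adj f g} + card (par f) + 1 = dB (top_end f) + dB (bot_end f)"
proof -
  let ?T = "{g \<in> Bs. top_end f \<in> en g}" and ?D = "{g \<in> Bs. bot_end f \<in> en g}"
  note e = ends_Bs[OF f]
  have "?T \<union> ?D = insert f {g \<in> Bs. adj f g}" using e f by (auto simp: adjacent_def)
  moreover have "f \<notin> {g \<in> Bs. adj f g}" by (simp add: adjacent_irrefl)
  ultimately have "card (?T \<union> ?D) = card {g \<in> Bs. adj f g} + 1" using fin_BR by simp
  moreover have "?T \<inter> ?D = par f"
  proof (intro equalityI subsetI)
    fix g assume g: "g \<in> ?T \<inter> ?D"
    then have "en g = {top_end f, bot_end f}" using ends_eq[of g] e(4) Bs_sub by blast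
    then show "g \<in> par f" using g e(1) Bs_sub by (auto simp: par_def)
  next
    fix g assume g: "g \<in> par f"
    then have "en g = en f" "g \<in> Bs" using par_Bs[OF f] by (auto simp: par_def)
    then show "g \<in> ?T \<inter> ?D" using e(1) by simp
  qed
  ultimately show ?thesis using card_Un_Int[of ?T ?D] fin_BR by (simp add: dB_def)
qed

lemma contradiction: False
proof -
  have "S \<noteq> {}" using not_colourable by (auto simp: list_colouring_def)
  then obtain e0 where e0: "e0 \<in> S" by blast
  then obtain v0 where "v0 \<in> en e0" using card_en S_sub by fastforce
  then have "e0 \<in> star v0" using e0 by (simp add: star_def)
  then have "deg v0 \<noteq> 0" unfolding deg_def by auto
  \<comment> \<open>Criticality needs a nonempty cut: at any vertex of an edge of \<open>S\<close>,
    at least half of the edges are cut.\<close>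
  then have "1 \<le> dB v0" using deg_split[of v0] dR_le_dB[of v0] by linarith
  then have "Bs \<noteq> {}" by (auto simp: dB_def)
  then have "S - Bs \<subset> S" using Bs_sub by blast
  then obtain c0 where c0: "list_colouring adj (S - Bs) L c0" using critical by blast
  obtain key where inj: "\<And>x. inj_on (key x) {f \<in> Bs. x \<in> en f}"
    and low: "\<And>f. f \<in> Bs \<Longrightarrow> card (par f) + 1
      \<le> card (lower key (top_end f) f) + card (lower key (bot_end f) f) + slack f"
    using preferences by auto
  define u where "u f = key (top_end f) f" for f
  define w where "w f = key (bot_end f) f" for f
  have inj': "f = g" if "f \<in> Bs" "g \<in> Bs" "x \<in> en f" "x \<in> en g" "key x f = key x g" for f g x
    using inj_onD[OF inj, of x f g] that by simp
  have in_en: "top_end f \<in> en f" "bot_end f \<in> en f" if "f \<in> Bs" for f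
    using ends_Bs(1)[OF that] by simp_all
  have dist_top: "pref_distinct top_end u Bs"
    unfolding pref_distinct_def u_def
  proof (intro ballI impI notI)
    fix e f assume "e \<in> Bs" "f \<in> Bs" "e \<noteq> f" "top_end e = top_end f"
      "key (top_end e) e = key (top_end f) f"
    then show False using inj'[of e f "top_end e"] in_en(1)[of e] in_en(1)[of f] by simp
  qed
  have dist_bot: "pref_distinct bot_end w Bs"
    unfolding pref_distinct_def w_def
  proof (intro ballI impI notI)
    fix e f assume "e \<in> Bs" "f \<in> Bs" "e \<noteq> f" "bot_end e = bot_end f"
      "key (bot_end e) e = key (bot_end f) f"
    then show False using inj'[of e f "bot_end e"] in_en(2)[of e] in_en(2)[of f] by simp
  qed
  \<comment> \<open>The better edges number \<open>dB\<close> at the top plus \<open>dB\<close> at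
    the bottom minus 2 minus the lower ones. The residual list has at least the same sum minus 2
    minus \<open>card (par f)\<close> plus \<open>slack f\<close> colours, so the preference bound
    gives the strict inequality.\<close>
  have rank: "card (better top_end u Bs f) + card (better bot_end w Bs f) < card (residual Bs c0 f)"
    if f: "f \<in> Bs" for f
  proof -
    note e = ends_Bs[OF f]
    have fS: "f \<in> S" using f Bs_sub by blast
    have t: "top_end f \<in> en f" and b: "bot_end f \<in> en f" using e(1) by auto
    have "better top_end u Bs f = {g \<in> Bs. top_end f \<in> en g \<and> key (top_end f) g < key (top_end f) f}"
      using in_ends_Bs(1) e(2) by (auto simp: better_def u_def)
    moreover have "better bot_end w Bs f = {g \<in> Bs. bot_end f \<in> en g \<and> key (bot_end f) g < key (bot_end f) f}"
      using in_ends_Bs(2) e(3) by (auto simp: better_def w_def)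
    ultimately have "card (better top_end u Bs f) + card (lower key (top_end f) f) + 1 = dB (top_end f)"
      "card (better bot_end w Bs f) + card (lower key (bot_end f) f) + 1 = dB (bot_end f)"
      using rank_lower[of key "top_end f" f, OF inj f t] rank_lower[of key "bot_end f" f, OF inj f b]
      by simp_all
    then show ?thesis
      using low[OF f] card_adjacent_Bs[OF f] card_residual[OF Bs_sub fS, of c0] slack(1)[OF fS] by linarith
  qed
  have "\<exists>c. (\<forall>f \<in> Bs. c f \<in> residual Bs c0 f) \<and>
    (\<forall>f \<in> Bs. \<forall>g \<in> Bs. f \<noteq> g \<longrightarrow> top_end f = top_end g \<or> bot_end f = bot_end g \<longrightarrow> c f \<noteq> c g)"
    by (rule galvin_list_colouring[OF fin_BR(1) dist_top dist_bot]) (rule rank)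
  then obtain c where c: "\<forall>f \<in> Bs. c f \<in> residual Bs c0 f"
    "\<forall>f \<in> Bs. \<forall>g \<in> Bs. f \<noteq> g \<longrightarrow> top_end f = top_end g \<or> bot_end f = bot_end g \<longrightarrow> c f \<noteq> c g"
    by (elim exE conjE)
  have "list_colouring adj Bs (residual Bs c0) c"
    unfolding list_colouring_def
  proof (intro conjI ballI impI)
    fix f g assume fg: "f \<in> Bs" "g \<in> Bs" "adj f g"
    then obtain x where x: "x \<in> en f" "x \<in> en g" "f \<noteq> g" by (auto simp: adjacent_def)
    then have "top_end f = top_end g \<or> bot_end f = bot_end g"
      using in_ends_Bs[OF fg(1), of x] in_ends_Bs[OF fg(2), of x] by (cases "x \<in> U") auto
    then show "c f \<noteq> c g" using c(2) fg x(3) by blast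
  qed (use c(1) in blast)
  then show False using residual_not_colourable[OF Bs_sub c0] by blast
qed

end

section \<open>Passage from critical sets of edges to line graphs\<close>

lemma (in critical_edges) no_critical_edges: False
proof -
  obtain U where "\<forall>W. card {e \<in> S. crosses W e} \<le> card {e \<in> S. crosses U e}"
    using max_cut_exists by blast
  then interpret max_cut en E S L k U by unfold_locales blast
  show False by (rule contradiction)
qed

theorem theorem6p6:
  fixes H :: "('v, 'e) pre_multigraph" and G :: "'e pre_sgraph"
  assumes "multigraph H"
    and "min_mdegree H \<ge> 7"
    and "G = line_graph H"
  shows "int (list_chromatic_number G) \<le> max (int (clique_number G)) (int (max_sdegree G) - 1)"
proof -
  interpret multigraph H by fact
  let ?E = "medges H" and ?adj = "adjacent (ends H)"
  have verts: "sverts G = ?E" by (simp add: assms(3) line_graph_def)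
  have edges: "{e, f} \<in> sedges G \<longleftrightarrow> ?adj e f" if "e \<in> ?E" "f \<in> ?E" for e f
    using that by (auto simp: assms(3) line_graph_def adjacent_def doubleton_eq_iff)
  \<comment> \<open>Truncated subtraction differs from the integer one only for maximum degree 0,
    where the maximum with the clique number absorbs it.\<close>
  define k where "k = max (clique_number G) (max_sdegree G - 1)"
  have "choosable G k"
    unfolding choosable_def
  proof (intro allI impI, rule ccontr)
    fix L :: "'e \<Rightarrow> nat set"
    assume L: "\<forall>v \<in> sverts G. finite (L v) \<and> card (L v) = k"
      and no_col: "\<not> (\<exists>c. proper_colouring G c \<and> (\<forall>v \<in> sverts G. c v \<in> L v))"
    define P where "P S \<longleftrightarrow> S \<subseteq> ?E \<and> \<not> (\<exists>c. list_colouring ?adj S L c)" for S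
    have "P ?E"
      using no_col edges unfolding P_def list_colouring_def proper_colouring_def verts by blast
    then obtain S where S: "P S" and S_min: "\<And>T. P T \<Longrightarrow> card S \<le> card T"
      using ex_has_least_nat[of P ?E card] by blast
    have finS: "finite S" using S finite_medges finite_subset by (auto simp: P_def)
    interpret critical_edges "ends H" ?E S L k
    proof
      show "7 \<le> card {f \<in> ?E. v \<in> ends H f}" if "e \<in> ?E" "v \<in> ends H e" for e v
      proof -
        have "v \<in> mverts H" using ends_subset[OF that(1)] that(2) by blast
        then have "min_mdegree H \<le> mdegree H v"
          unfolding min_mdegree_def using finite_mverts by (intro Min_le) auto
        then show ?thesis using assms(2) by (simp add: mdegree_def)
      qed
      show "card {f \<in> ?E. ?adj e f} \<le> k + 1" if e: "e \<in> ?E" for e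
      proof -
        have "sdegree G e = card {f \<in> ?E. ?adj e f}"
          unfolding sdegree_def verts using edges[OF e] by (metis (no_types, lifting))
        moreover have "sdegree G e \<le> max_sdegree G"
          unfolding max_sdegree_def verts using e finite_medges by (intro Max_ge) auto
        ultimately show ?thesis by (simp add: k_def)
      qed
      show "card K \<le> k" if K: "K \<subseteq> ?E" "\<And>e f. \<lbrakk>e \<in> K; f \<in> K; e \<noteq> f\<rbrakk> \<Longrightarrow> ?adj e f" for K
      proof -
        let ?C = "{card K | K. K \<subseteq> sverts G \<and> clique K (sedges G)}"
        have "?C \<subseteq> {..card ?E}" using finite_medges by (auto simp: verts card_mono)
        then have "finite ?C" by (rule finite_subset) simp
        moreover have "clique K (sedges G)"
          unfolding clique_def using K edges by (meson subsetD)
        then have "card K \<in> ?C" using K(1) verts by blast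
        ultimately have "card K \<le> clique_number G" unfolding clique_number_def by (rule Max_ge)
        then show ?thesis by (simp add: k_def)
      qed
      show "\<exists>c. list_colouring ?adj T L c" if "T \<subset> S" for T
      proof -
        have "card T < card S" using that finS by (rule psubset_card_mono[rotated])
        then have "\<not> P T" using S_min by (meson leD)
        then show ?thesis using that S by (auto simp: P_def)
      qed
    qed (use S L finite_medges card_ends verts in \<open>auto simp: P_def\<close>)
    show False by (rule no_critical_edges)
  qed
  then have "list_chromatic_number G \<le> k"
    unfolding list_chromatic_number_def by (rule Least_le)
  then show ?thesis by (auto simp: k_def max_def split: if_splits)
qed

end
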